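(* Let $P$ be a polynomial on $\mathbb C$ (in one complex variable, with complex coefficients). Then its graph $\{(z,\zeta)\in\mathbb C^2:\zeta=P(z)\}$ is interpolating for the Bargmann--Fock space on $\mathbb C^2$.
   Context: The Bargmann--Fock space on $\mathbb C^n$ is the space of all entire functions $F$ on $\mathbb C^n$ with $\int_{\mathbb C^n}|F|^2e^{-|\cdot|^2}<\infty$, the integral being with respect to Lebesgue measure and $|\cdot|$ being the Euclidean norm. An analytic hypersurface $W\subset\mathbb C^n$ is called interpolating for the Bargmann--Fock space on $\mathbb C^n$ if for every holomorphic function $f$ on $W$ with $\int_W|f|^2e^{-|\cdot|^2}<\infty$ (integration with respect to the volume measure on $W$ induced by the Euclidean metric of $\mathbb C^n$) there is an entire function $F$ on $\mathbb C^n$ with $F|_W=f$ and $\int_{\mathbb C^n}|F|^2e^{-|\cdot|^2}<\infty$. *)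

theory Defs
  imports "HOL-Analysis.Analysis" "HOL-Computational_Algebra.Polynomial"
begin

text \<open>Complex \<open>n\<close>-space is \<^typ>\<open>complex ^ 'n\<close> with \<open>n = CARD('n)\<close>; its \<^const>\<open>norm\<close> is the Euclidean
  norm and its \<^const>\<open>lborel\<close> is Lebesgue measure. A function of several complex variables is
  holomorphic on an open set iff it has a complex-linear derivative at every point of it.\<close>

definition holomorphic_in :: "(complex ^ 'n \<Rightarrow> complex) \<Rightarrow> (complex ^ 'n) set \<Rightarrow> bool"
    (infixl \<open>holomorphic'_in\<close> 50) where
  "f holomorphic_in U \<longleftrightarrow>
     (\<forall>z\<in>U. \<exists>D. (f has_derivative D) (at z) \<and> (\<forall>c v. D (c *s v) = c * D v))"

definition bargmann_fock :: "(complex ^ 'n \<Rightarrow> complex) set" where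
  "bargmann_fock = {F. F holomorphic_in UNIV \<and>
     (\<integral>\<^sup>+ z. ennreal ((cmod (F z))\<^sup>2 * exp (- (norm z)\<^sup>2)) \<partial>lborel) < \<infinity>}"

text \<open>The point \<open>p\<close> ranges over the whole space, so that \<open>W\<close> is closed.\<close>

definition analytic_hypersurface :: "(complex ^ 'n) set \<Rightarrow> bool" where
  "analytic_hypersurface W \<longleftrightarrow>
     (\<forall>p. \<exists>U h. open U \<and> connected U \<and> p \<in> U \<and> h holomorphic_in U \<and>
        (\<exists>z\<in>U. h z \<noteq> 0) \<and> W \<inter> U = {z \<in> U. h z = 0})"

text \<open>Holomorphic functions on a (possibly singular) analytic subset: those that locally extend
  holomorphically to the ambient space. Only the values of \<open>f\<close> on \<open>W\<close> matter.\<close>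

definition holomorphic_on_subvariety :: "(complex ^ 'n \<Rightarrow> complex) \<Rightarrow> (complex ^ 'n) set \<Rightarrow> bool" where
  "holomorphic_on_subvariety f W \<longleftrightarrow>
     (\<forall>p\<in>W. \<exists>U g. open U \<and> p \<in> U \<and> g holomorphic_in U \<and> (\<forall>z\<in>W \<inter> U. f z = g z))"

text \<open>Riemannian volume of a \<open>d\<close>-dimensional set \<open>S\<close>, where \<open>d = DIM('d)\<close> and \<open>'d\<close> is the Euclidean
  space in which the local parametrizations of \<open>S\<close> are defined. In such a parametrization \<open>\<phi>\<close> the
  metric induced on \<open>S\<close> has the Gram matrix of the derivative of \<open>\<phi>\<close> as coefficient matrix, so that
  the volume form is the square root of the Gram determinant. The determinant is spelled out
  because its rows and columns are indexed by the set \<^const>\<open>Basis\<close> and not by a type.\<close>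

definition gram_det :: "('d::euclidean_space \<Rightarrow> 'a::euclidean_space) \<Rightarrow> real" where
  "gram_det L = (\<Sum>p | p permutes Basis. of_int (sign p) * (\<Prod>b\<in>Basis. L b \<bullet> L (p b)))"

definition local_parametrization ::
    "'a::euclidean_space set \<Rightarrow> 'd::euclidean_space set \<Rightarrow> ('d \<Rightarrow> 'a) \<Rightarrow> bool" where
  "local_parametrization S V \<phi> \<longleftrightarrow>
     open V \<and> openin (top_of_set S) (\<phi> ` V) \<and> (\<exists>\<psi>. homeomorphism V (\<phi> ` V) \<phi> \<psi>) \<and>
     (\<exists>\<phi>' :: 'd \<Rightarrow> 'd \<Rightarrow>\<^sub>L 'a. continuous_on V \<phi>' \<and>
        (\<forall>x\<in>V. (\<phi> has_derivative blinfun_apply (\<phi>' x)) (at x) \<and> inj (blinfun_apply (\<phi>' x))))"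

definition parametrized_pieces ::
    "'a::euclidean_space set \<Rightarrow> (('d::euclidean_space \<Rightarrow> 'a) \<times> 'd set) set" where
  "parametrized_pieces S = {(\<phi>, A). A \<in> sets borel \<and> (\<exists>V. local_parametrization S V \<phi> \<and> A \<subseteq> V)}"

definition piece_image :: "('d::euclidean_space \<Rightarrow> 'a::euclidean_space) \<times> 'd set \<Rightarrow> 'a set" where
  "piece_image = (\<lambda>(\<phi>, A). \<phi> ` A)"

definition piece_volume :: "('d::euclidean_space \<Rightarrow> 'a::euclidean_space) \<times> 'd set \<Rightarrow> ennreal" where
  "piece_volume = (\<lambda>(\<phi>, A).
     \<integral>\<^sup>+ x\<in>A. ennreal (sqrt (gram_det (frechet_derivative \<phi> (at x)))) \<partial>lborel)"

text \<open>The volume of a Borel set \<open>B \<subseteq> S\<close> is the total volume of the pieces into which \<open>B\<close> is cut by local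
  parametrizations. As finitely many pieces need not exhaust \<open>B\<close>, the supremum is taken. Points of
  \<open>S\<close> without a local parametrization (singular points) do not contribute.\<close>

definition packings ::
    "'a::euclidean_space set \<Rightarrow> 'a set \<Rightarrow> (('d::euclidean_space \<Rightarrow> 'a) \<times> 'd set) set set" where
  "packings S B = {T. finite T \<and> T \<subseteq> parametrized_pieces S \<and>
     disjoint_family_on piece_image T \<and> (\<forall>t\<in>T. piece_image t \<subseteq> B)}"

definition volume_measure ::
    "'d::euclidean_space itself \<Rightarrow> 'a::euclidean_space set \<Rightarrow> 'a measure" where
  "volume_measure _ S = measure_of S (sets (restrict_space borel S))
     (\<lambda>B. SUP T \<in> (packings S B :: (('d \<Rightarrow> 'a) \<times> 'd set) set set). \<Sum>t\<in>T. piece_volume t)"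

text \<open>The supremum above is indeed a measure on the Borel subsets of \<open>S\<close>, so \<^const>\<open>measure_of\<close> does not
  fall back to the zero measure.\<close>

lemma parametrized_piecesE:
  assumes "(\<phi>, A) \<in> parametrized_pieces S"
  obtains V where "A \<in> sets borel" "local_parametrization S V \<phi>" "A \<subseteq> V" "continuous_on V \<phi>"
    "\<phi> ` V \<subseteq> S" "V \<in> sets borel"
    "(\<lambda>x. ennreal (sqrt (gram_det (frechet_derivative \<phi> (at x)))) * indicator V x)
       \<in> borel_measurable borel"
proof -
  from assms obtain V where V: "A \<in> sets borel" "local_parametrization S V \<phi>" "A \<subseteq> V"
    by (auto simp: parametrized_pieces_def)
  from V(2) obtain \<psi> where "homeomorphism V (\<phi> ` V) \<phi> \<psi>"
    by (auto simp: local_parametrization_def)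
  then have c: "continuous_on V \<phi>" by (simp add: homeomorphism_def)
  from V(2) have s: "\<phi> ` V \<subseteq> S" "open V"
    unfolding local_parametrization_def by (auto dest: openin_imp_subset)
  from V(2) obtain \<phi>' where p: "continuous_on V \<phi>'"
    "\<And>x. x \<in> V \<Longrightarrow> (\<phi> has_derivative blinfun_apply (\<phi>' x)) (at x)"
    by (auto simp: local_parametrization_def)
  have "frechet_derivative \<phi> (at x) = blinfun_apply (\<phi>' x)" if "x \<in> V" for x
    using frechet_derivative_at[OF p(2)[OF that]] by simp
  moreover have "continuous_on V (\<lambda>x. sqrt (gram_det (blinfun_apply (\<phi>' x))))"
    unfolding gram_det_def by (intro continuous_intros p)
  ultimately have "continuous_on V (\<lambda>x. sqrt (gram_det (frechet_derivative \<phi> (at x))))"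
    by (simp cong: continuous_on_cong)
  then have "(\<lambda>x. indicator V x *\<^sub>R sqrt (gram_det (frechet_derivative \<phi> (at x)))) \<in> borel_measurable borel"
    using s by (intro borel_measurable_continuous_on_indicator) auto
  then have "(\<lambda>x. ennreal (indicator V x *\<^sub>R sqrt (gram_det (frechet_derivative \<phi> (at x)))))
      \<in> borel_measurable borel"
    by measurable
  also have "(\<lambda>x. ennreal (indicator V x *\<^sub>R sqrt (gram_det (frechet_derivative \<phi> (at x))))) =
      (\<lambda>x. ennreal (sqrt (gram_det (frechet_derivative \<phi> (at x)))) * indicator V x)"
    by (auto simp: indicator_def)
  finally show thesis using s(2) by (intro that[OF V c s(1)]) auto
qed

lemma parametrized_pieces_restrict:
  assumes "(\<phi>, A) \<in> parametrized_pieces S" "B \<in> sets (restrict_space borel S)"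
  shows "(\<phi>, A \<inter> \<phi> -` B) \<in> parametrized_pieces S"
proof -
  from assms(1) obtain V where V: "A \<in> sets borel" "local_parametrization S V \<phi>" "A \<subseteq> V"
    "continuous_on V \<phi>" "\<phi> ` V \<subseteq> S"
    by (rule parametrized_piecesE) blast
  obtain B' where B': "B' \<in> sets borel" "B = S \<inter> B'"
    using assms(2) by (auto simp: sets_restrict_space)
  have "\<phi> \<in> borel_measurable (restrict_space borel A)"
    using V by (intro borel_measurable_continuous_on_restrict) (auto intro: continuous_on_subset)
  from measurable_sets[OF this B'(1)] have "\<phi> -` B' \<inter> A \<in> sets (restrict_space borel A)"
    by (simp add: space_restrict_space)
  then have "\<phi> -` B' \<inter> A \<in> sets borel"
    using V(1) by (simp add: sets_restrict_space_iff)
  moreover have "A \<inter> \<phi> -` B = \<phi> -` B' \<inter> A" using V(3,5) B'(2) by auto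
  ultimately show ?thesis
    using V by (auto simp: parametrized_pieces_def)
qed

lemma piece_volume_empty [simp]: "piece_volume (\<phi>, {}) = 0"
  by (simp add: piece_volume_def)

lemma piece_volume_eq_0: "piece_image t = {} \<Longrightarrow> piece_volume t = 0"
  by (cases t) (simp add: piece_image_def)

lemma piece_volume_suminf:
  assumes A: "(\<phi>, A) \<in> parametrized_pieces S"
    and B: "\<And>n::nat. B n \<in> sets (restrict_space borel S)" "disjoint_family B" "\<phi> ` A \<subseteq> (\<Union>n. B n)"
  shows "piece_volume (\<phi>, A) = (\<Sum>n. piece_volume (\<phi>, A \<inter> \<phi> -` B n))"
proof -
  from A obtain V where V: "A \<subseteq> V"
    "(\<lambda>x. ennreal (sqrt (gram_det (frechet_derivative \<phi> (at x)))) * indicator V x)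
       \<in> borel_measurable borel" (is "?J \<in> _")
    by (rule parametrized_piecesE) blast
  have eq: "piece_volume (\<phi>, C) = (\<integral>\<^sup>+ x\<in>C. ?J x \<partial>lborel)" if "C \<subseteq> A" for C
    unfolding piece_volume_def using subset_trans[OF that V(1)]
    by (auto intro!: nn_integral_cong simp: indicator_def)
  have "piece_volume (\<phi>, A) = (\<integral>\<^sup>+ x\<in>(\<Union>n. A \<inter> \<phi> -` B n). ?J x \<partial>lborel)"
  proof -
    have "(\<Union>n. A \<inter> \<phi> -` B n) = A" using B(3) by blast
    then show ?thesis by (simp add: eq)
  qed
  also have "\<dots> = (\<Sum>n. \<integral>\<^sup>+ x\<in>(A \<inter> \<phi> -` B n). ?J x \<partial>lborel)"
    using V(2) parametrized_pieces_restrict[OF A B(1)] B(2)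
    by (intro nn_integral_disjoint_family)
      (auto simp: parametrized_pieces_def disjoint_family_on_def disjoint_iff)
  finally show ?thesis by (simp add: eq)
qed

lemma packings_restrict:
  fixes T :: "(('d::euclidean_space \<Rightarrow> 'a::euclidean_space) \<times> 'd set) set"
  assumes T: "T \<in> packings S C" and B: "B \<in> sets (restrict_space borel S)"
  shows "(\<Sum>(\<phi>, A)\<in>T. piece_volume (\<phi>, A \<inter> \<phi> -` B)) \<le>
    (SUP T\<in>(packings S B :: (('d \<Rightarrow> 'a) \<times> 'd set) set set). \<Sum>t\<in>T. piece_volume t)"
proof -
  define h where "h = (\<lambda>(\<phi> :: 'd \<Rightarrow> 'a, A). (\<phi>, A \<inter> \<phi> -` B))"
  have sub: "piece_image (h t) \<subseteq> piece_image t \<inter> B" for t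
    by (auto simp: h_def piece_image_def split: prod.splits)
  have disj: "piece_image s \<inter> piece_image t = {}"
    if "s \<in> T" "t \<in> T" "s \<noteq> t" for s t
    using T that by (auto simp: packings_def disjoint_family_on_def)
  have "h ` T \<in> packings S B"
    unfolding packings_def mem_Collect_eq
  proof (intro conjI)
    show "finite (h ` T)" using T by (simp add: packings_def)
    show "h ` T \<subseteq> parametrized_pieces S"
      using T parametrized_pieces_restrict[OF _ B] by (fastforce simp: packings_def h_def)
    show "disjoint_family_on piece_image (h ` T)"
      unfolding disjoint_family_on_def using disj sub by blast
    show "\<forall>t\<in>h ` T. piece_image t \<subseteq> B" using sub by blast
  qed
  moreover have "(\<Sum>t\<in>h ` T. piece_volume t) = (\<Sum>t\<in>T. piece_volume (h t))"
  proof (subst sum.reindex_nontrivial)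
    show "finite T" using T by (simp add: packings_def)
    show "piece_volume (h s) = 0" if st: "s \<in> T" "t \<in> T" "s \<noteq> t" "h s = h t" for s t
    proof -
      have "piece_image (h s) = {}"
        using disj[OF st(1-3)] sub[of s] sub[of t] unfolding st(4) by blast
      then show ?thesis by (rule piece_volume_eq_0)
    qed
  qed simp
  moreover have "(\<Sum>t\<in>T. piece_volume (h t)) = (\<Sum>(\<phi>, A)\<in>T. piece_volume (\<phi>, A \<inter> \<phi> -` B))"
    by (auto intro!: sum.cong simp: h_def)
  ultimately show ?thesis using SUP_upper[of "h ` T" "packings S B" "sum piece_volume"] by simp
qed

lemma packings_superadditive:
  fixes S :: "'a::euclidean_space set"
  defines "P \<equiv> (packings S :: 'a set \<Rightarrow> (('d::euclidean_space \<Rightarrow> 'a) \<times> 'd set) set set)"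
  assumes "B \<inter> C = {}"
  shows "(SUP T\<in>P B. \<Sum>t\<in>T. piece_volume t) + (SUP T\<in>P C. \<Sum>t\<in>T. piece_volume t)
    \<le> (SUP T\<in>P (B \<union> C). \<Sum>t\<in>T. piece_volume t)"
proof -
  have ne: "P X \<noteq> {}" for X :: "'a set"
    by (auto simp: P_def packings_def disjoint_family_on_def intro: exI[of _ "{}"])
  have *: "sum piece_volume T + sum piece_volume U \<le> (SUP T\<in>P (B \<union> C). \<Sum>t\<in>T. piece_volume t)"
    if T: "T \<in> P B" and U: "U \<in> P C" for T U :: "(('d \<Rightarrow> 'a) \<times> 'd set) set"
  proof -
    have sub: "piece_image t \<subseteq> B" if "t \<in> T" for t
      using T that unfolding P_def packings_def by blast
    have sub': "piece_image t \<subseteq> C" if "t \<in> U" for t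
      using U that unfolding P_def packings_def by blast
    have disj: "piece_image s \<inter> piece_image t = {}"
      if "s \<in> T \<union> U" "t \<in> T \<union> U" "s \<noteq> t" for s t
    proof (cases "s \<in> T \<longleftrightarrow> t \<in> T")
      case True
      then show ?thesis
        using T U that unfolding P_def packings_def disjoint_family_on_def by blast
    next
      case False
      then show ?thesis using sub[of s] sub[of t] sub'[of s] sub'[of t] that assms by blast
    qed
    have "T \<union> U \<in> P (B \<union> C)"
      unfolding P_def packings_def mem_Collect_eq
    proof (intro conjI)
      show "finite (T \<union> U)" "T \<union> U \<subseteq> parametrized_pieces S"
        using T U by (auto simp: P_def packings_def)
      show "disjoint_family_on piece_image (T \<union> U)"
        unfolding disjoint_family_on_def using disj by blast
      show "\<forall>t\<in>T \<union> U. piece_image t \<subseteq> B \<union> C"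
        using sub sub' by fast
    qed
    then have "sum piece_volume (T \<union> U) \<le> (SUP T\<in>P (B \<union> C). \<Sum>t\<in>T. piece_volume t)"
      by (rule SUP_upper)
    moreover have "sum piece_volume (T \<inter> U) = 0"
    proof (rule sum.neutral, rule ballI)
      fix t assume "t \<in> T \<inter> U"
      then have "piece_image t = {}" using sub[of t] sub'[of t] assms by blast
      then show "piece_volume t = 0" by (rule piece_volume_eq_0)
    qed
    moreover have "finite T" "finite U" using T U by (auto simp: P_def packings_def)
    ultimately show ?thesis using sum.union_inter[of T U piece_volume] by simp
  qed
  have "sum piece_volume T + (SUP U\<in>P C. sum piece_volume U) \<le> (SUP T\<in>P (B \<union> C). \<Sum>t\<in>T. piece_volume t)"
    if T: "T \<in> P B" for T
    unfolding ennreal_SUP_add_right[OF ne] by (intro SUP_least * T)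
  then show ?thesis
    unfolding ennreal_SUP_add_left[OF ne, symmetric] by (intro SUP_least)
qed

lemma packings_mono: "B \<subseteq> C \<Longrightarrow> packings S B \<subseteq> packings S C"
  unfolding packings_def by blast

lemma emeasure_volume_measure:
  fixes S :: "'a::euclidean_space set"
  assumes B: "B \<in> sets (restrict_space borel S)"
  shows "emeasure (volume_measure TYPE('d::euclidean_space) S) B =
    (SUP T \<in> (packings S B :: (('d \<Rightarrow> 'a) \<times> 'd set) set set). \<Sum>t\<in>T. piece_volume t)"
proof -
  let ?M = "sets (restrict_space borel S)"
  define \<mu> where
    "\<mu> B = (SUP T \<in> (packings S B :: (('d \<Rightarrow> 'a) \<times> 'd set) set set). \<Sum>t\<in>T. piece_volume t)" for B
  have 0: "\<mu> {} = 0"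
  proof -
    have "sum piece_volume T = 0" if "T \<in> packings S {}" for T :: "(('d \<Rightarrow> 'a) \<times> 'd set) set"
      using that by (auto simp: packings_def intro!: sum.neutral piece_volume_eq_0)
    then show ?thesis unfolding \<mu>_def by (intro antisym SUP_least) auto
  qed
  have "countably_additive ?M \<mu>"
    unfolding countably_additive_def
  proof (intro allI impI antisym)
    fix B :: "nat \<Rightarrow> 'a set" assume B: "range B \<subseteq> ?M" "disjoint_family B"
    have "(\<Sum>n<N. \<mu> (B n)) \<le> \<mu> (\<Union>n<N. B n)" for N
    proof (induction N)
      case (Suc N)
      have "(\<Union>n<N. B n) \<inter> B N = {}"
        using B(2) unfolding disjoint_family_on_def disjoint_iff by (metis UN_E UNIV_I lessThan_iff less_irrefl)
      from packings_superadditive[OF this, of S, where 'd = 'd]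
      have "\<mu> (\<Union>n<N. B n) + \<mu> (B N) \<le> \<mu> ((\<Union>n<N. B n) \<union> B N)" unfolding \<mu>_def .
      moreover have "(\<Union>n<N. B n) \<union> B N = (\<Union>n<Suc N. B n)" by (auto simp: less_Suc_eq)
      moreover have "(\<Sum>n<Suc N. \<mu> (B n)) \<le> \<mu> (\<Union>n<N. B n) + \<mu> (B N)"
        using Suc by (simp add: add_right_mono)
      ultimately show ?case by (metis order_trans)
    qed (simp add: 0)
    moreover have "\<mu> (\<Union>n<N. B n) \<le> \<mu> (\<Union>n. B n)" for N :: nat
      unfolding \<mu>_def by (intro SUP_subset_mono packings_mono) auto
    ultimately show "(\<Sum>n. \<mu> (B n)) \<le> \<mu> (\<Union>n. B n)"
      by (intro suminf_le_const) (auto intro: order_trans)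
    show "\<mu> (\<Union>n. B n) \<le> (\<Sum>n. \<mu> (B n))"
      unfolding \<mu>_def[of "\<Union>n. B n"]
    proof (rule SUP_least)
      fix T :: "(('d \<Rightarrow> 'a) \<times> 'd set) set" assume T: "T \<in> packings S (\<Union>n. B n)"
      have "sum piece_volume T = (\<Sum>(\<phi>, A)\<in>T. \<Sum>n. piece_volume (\<phi>, A \<inter> \<phi> -` B n))"
      proof (intro sum.cong refl, clarify)
        fix \<phi> A assume "(\<phi>, A) \<in> T"
        then have "(\<phi>, A) \<in> parametrized_pieces S" "\<phi> ` A \<subseteq> (\<Union>n. B n)"
          using T unfolding packings_def by (blast, force simp: piece_image_def)
        then show "piece_volume (\<phi>, A) = (\<Sum>n. piece_volume (\<phi>, A \<inter> \<phi> -` B n))"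
          using B by (intro piece_volume_suminf) auto
      qed
      also have "\<dots> = (\<Sum>n. \<Sum>(\<phi>, A)\<in>T. piece_volume (\<phi>, A \<inter> \<phi> -` B n))"
        by (simp add: case_prod_unfold suminf_sum)
      also have "\<dots> \<le> (\<Sum>n. \<mu> (B n))"
        using B(1) unfolding \<mu>_def by (intro suminf_le packings_restrict[OF T]) auto
      finally show "sum piece_volume T \<le> (\<Sum>n. \<mu> (B n))" .
    qed
  qed
  moreover have "positive ?M \<mu>" using 0 by (simp add: positive_def)
  moreover have "sigma_algebra S ?M"
    using sets.sigma_algebra_axioms[of "restrict_space borel S"] by (simp add: space_restrict_space)
  ultimately have "emeasure (measure_of S ?M \<mu>) B = \<mu> B"
    using emeasure_measure_of_sigma B by blast
  then show ?thesis unfolding volume_measure_def \<mu>_def .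
qed

text \<open>The type argument is any Euclidean space of the real dimension \<open>2n - 2\<close> of a hypersurface;
  for \<open>n = 2\<close> it can be \<^typ>\<open>complex\<close>.\<close>

definition interpolating :: "'d::euclidean_space itself \<Rightarrow> (complex ^ 'n) set \<Rightarrow> bool" where
  "interpolating D W \<longleftrightarrow>
     DIM('d) + 2 = 2 * CARD('n) \<and> analytic_hypersurface W \<and>
     (\<forall>f. holomorphic_on_subvariety f W \<longrightarrow>
        (\<integral>\<^sup>+ z. ennreal ((cmod (f z))\<^sup>2 * exp (- (norm z)\<^sup>2)) \<partial>volume_measure D W) < \<infinity> \<longrightarrow>
        (\<exists>F\<in>bargmann_fock. \<forall>z\<in>W. F z = f z))"

end

theory Submission
  imports Defs "HOL-Probability.Distributions" "HOL-Complex_Analysis.Cauchy_Integral_Formula"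
    "HOL-Computational_Algebra.Fundamental_Theorem_Algebra"
begin

text \<open>
  Put \<open>\<psi> w = |w|\<^sup>2 + |P w|\<^sup>2\<close>, the Gaussian weight at the point of the graph over \<open>w\<close>. A holomorphic
  function \<open>f\<close> on the graph is an entire function \<open>g w = f (w, P w)\<close>, and the area element of the
  graph is \<open>1 + |P'|\<^sup>2\<close> times Lebesgue measure. The extension is explicit: with the difference
  quotient \<open>q z w = (P z - P w) / (z - w)\<close> and \<open>c = \<integral> exp (- |w|\<^sup>2)\<close>,
    \<open>F (z, \<zeta>) = c\<inverse> \<integral> g w \<cdot> exp (z \<cdot> cnj w + \<zeta> \<cdot> cnj (P w) - \<psi> w) \<cdot> (1 + q z w \<cdot> cnj (P' w)) dw\<close>.
  Since \<open>q\<close> is a polynomial, \<open>F\<close> is holomorphic in both variables (\<open>kernel_extension_holomorphic\<close>).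

  \<open>F\<close> extends \<open>f\<close> (\<open>reproducing_identity\<close>): for \<open>\<zeta> = P z\<close> put
  \<open>S w = |w - z|\<^sup>2 + |P w - P z|\<^sup>2\<close>. Up to a factor that is holomorphic in \<open>w\<close> and equals \<open>1\<close> at
  \<open>w = z\<close>, the kernel is \<open>exp (- S)\<close> times the \<open>cnj w\<close>-derivative of \<open>S\<close>, divided by \<open>w - z\<close>; that is,
  the \<open>cnj w\<close>-derivative of \<open>- exp (- S) / (w - z)\<close>. So the identity is a Cauchy-Pompeiu formula.
  The singularity is removed by subtracting from \<open>g\<close> its value at \<open>z\<close>, and from \<open>exp (- S)\<close> the
  Gaussian \<open>exp (- |w - z|\<^sup>2)\<close>; what is left is Stokes' theorem for integrable functions on the
  plane (\<open>integral_dbar_eq_0\<close>).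

  \<open>F\<close> is square integrable (\<open>kernel_extension_square_integrable\<close>): for \<open>v = (z, \<zeta>)\<close>, the modulus of
  the exponential times \<open>exp (- |v|\<^sup>2 / 2)\<close> is \<open>exp (- \<psi> w / 2) \<cdot> exp (- |v - (w, P w)|\<^sup>2 / 2)\<close>. The
  remaining factor is \<open>O (1 + |P' w|\<^sup>2)\<close>, up to powers of \<open>1 + |w - z|\<close> which the Gaussian absorbs. So
  \<open>F\<close> is dominated by a Gaussian average of \<open>|g| exp (- \<psi> / 2)\<close> over the graph, and Schur's test asks
  for a bound on the area of the graph in a Gaussian window, uniform in the centre of the window
  (\<open>graph_gaussian_area_bounded\<close>). Such a bound holds because the graph has at most \<open>degree P\<close> sheets
  over the \<open>\<zeta>\<close>-plane if \<open>P\<close> is not constant, and is a complex line otherwise.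
\<close>

section \<open>Gaussian integrals\<close>

lemma gaussian_nn_integral_finite:
  fixes c :: real
  assumes "0 < c"
  shows "(\<integral>\<^sup>+ x. ennreal (exp (- c * (norm (x::'a::euclidean_space))\<^sup>2)) \<partial>lborel) < \<infinity>"
proof -
  define \<sigma> where "\<sigma> = sqrt (1 / (2 * c))"
  have \<sigma>: "\<sigma> > 0" "\<sigma>\<^sup>2 = 1 / (2 * c)"
    using assms by (simp_all add: \<sigma>_def)
  have "integrable lborel (\<lambda>x. sqrt (2 * pi * \<sigma>\<^sup>2) * normal_density 0 \<sigma> x)"
    using \<sigma> by (intro integrable_mult_right integrable_normal_density)
  also have "(\<lambda>x. sqrt (2 * pi * \<sigma>\<^sup>2) * normal_density 0 \<sigma> x) = (\<lambda>x. exp (- c * x\<^sup>2))"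
    using assms by (simp add: normal_density_def fun_eq_iff \<sigma>(2))
  finally have "(\<integral>\<^sup>+ x. ennreal (exp (- c * x\<^sup>2)) \<partial>lborel) < \<infinity>"
    by (simp add: integrable_iff_bounded)
  then have "(\<Prod>b\<in>(Basis :: 'a set). \<integral>\<^sup>+ x. ennreal (exp (- c * x\<^sup>2)) \<partial>lborel) < \<infinity>"
    by (simp add: power_less_top_ennreal)
  moreover have "ennreal (exp (- c * (norm x)\<^sup>2)) = (\<Prod>b\<in>Basis. ennreal (exp (- c * (x \<bullet> b)\<^sup>2)))"
    for x :: 'a
  proof -
    have "- c * (norm x)\<^sup>2 = (\<Sum>b\<in>Basis. - c * (x \<bullet> b)\<^sup>2)"
      unfolding power2_norm_eq_inner euclidean_inner[of x x] by (simp add: sum_distrib_left power2_eq_square)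
    then show ?thesis
      by (simp add: prod_ennreal exp_sum)
  qed
  ultimately show ?thesis
    using nn_integral_lborel_prod[where f = "\<lambda>(_::'a) x. ennreal (exp (- c * x\<^sup>2))"] by simp
qed

lemma nn_integral_lborel_translate:
  fixes a :: "'a::euclidean_space"
  assumes [measurable]: "f \<in> borel_measurable borel"
  shows "(\<integral>\<^sup>+ x. f (x - a) \<partial>lborel) = (\<integral>\<^sup>+ x. f x \<partial>lborel)"
proof -
  have "(\<integral>\<^sup>+ x. f x \<partial>lborel) = (\<integral>\<^sup>+ x. f x \<partial>distr lborel borel ((+) (- a)))"
    by (simp only: lborel_distr_plus)
  also have "\<dots> = (\<integral>\<^sup>+ x. f (x - a) \<partial>lborel)"
    by (subst nn_integral_distr) auto
  finally show ?thesis by simp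
qed

lemma nn_integral_lborel_rescale:
  fixes s :: real
  assumes [measurable]: "f \<in> borel_measurable borel" and "0 < s"
  shows "(\<integral>\<^sup>+ x. ennreal (s ^ DIM('a)) * f (s *\<^sub>R x) \<partial>lborel) =
    (\<integral>\<^sup>+ x. f (x::'a::euclidean_space) \<partial>lborel)"
proof -
  have "(\<integral>\<^sup>+ x. f x \<partial>lborel) =
      (\<integral>\<^sup>+ x. f x \<partial>density (distr lborel borel (\<lambda>x::'a. 0 + s *\<^sub>R x)) (\<lambda>_. \<bar>s\<bar> ^ DIM('a)))"
    using lborel_affine[of s "0::'a"] assms(2) by simp
  also have "\<dots> = (\<integral>\<^sup>+ x. ennreal (s ^ DIM('a)) * f (s *\<^sub>R x) \<partial>lborel)"
    using assms(2) by (subst nn_integral_density) (auto simp: nn_integral_distr)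
  finally show ?thesis by simp
qed

lemma nn_integral_gaussian_translate:
  fixes a :: "'a::euclidean_space"
  shows "(\<integral>\<^sup>+ x. ennreal (exp (- c * (norm (x - a))\<^sup>2)) \<partial>lborel) =
    (\<integral>\<^sup>+ x. ennreal (exp (- c * (norm (x::'a))\<^sup>2)) \<partial>lborel)"
  by (rule nn_integral_lborel_translate) measurable

lemma nn_integral_gaussian_rescale:
  fixes a :: complex
  assumes "0 < s"
  shows "(\<integral>\<^sup>+ w. ennreal (s\<^sup>2 * exp (- c * s\<^sup>2 * (cmod (w - a))\<^sup>2)) \<partial>lborel) =
    (\<integral>\<^sup>+ w. ennreal (exp (- c * (cmod w)\<^sup>2)) \<partial>lborel)"
proof -
  have "(\<integral>\<^sup>+ w. ennreal (s\<^sup>2 * exp (- c * s\<^sup>2 * (cmod (w - a))\<^sup>2)) \<partial>lborel) =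
      (\<integral>\<^sup>+ w. ennreal (s\<^sup>2 * exp (- c * s\<^sup>2 * (cmod w)\<^sup>2)) \<partial>lborel)"
    by (rule nn_integral_lborel_translate[where f = "\<lambda>w. ennreal (s\<^sup>2 * exp (- c * s\<^sup>2 * (cmod w)\<^sup>2))"]) measurable
  also have "\<dots> = (\<integral>\<^sup>+ w. ennreal (s ^ DIM(complex)) * ennreal (exp (- c * (norm (s *\<^sub>R (w::complex)))\<^sup>2)) \<partial>lborel)"
    using assms by (auto intro!: nn_integral_cong simp: ennreal_mult[symmetric] power_mult_distrib mult_ac)
  also have "\<dots> = (\<integral>\<^sup>+ w. ennreal (exp (- c * (cmod w)\<^sup>2)) \<partial>lborel)"
    using assms by (intro nn_integral_lborel_rescale) measurable
  finally show ?thesis .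
qed

section \<open>Wirtinger derivatives and Stokes' theorem in the plane\<close>

text \<open>A real-linear map of the plane is \<open>h \<mapsto> a * h + b * cnj h\<close>; for the derivative of \<open>f\<close>, the
  coefficients \<open>a\<close> and \<open>b\<close> are the Wirtinger derivatives of \<open>f\<close> with respect to \<open>w\<close> and \<open>cnj w\<close>.\<close>

lemma has_derivative_wirtinger_mult:
  fixes f g :: "complex \<Rightarrow> complex"
  assumes "(f has_derivative (\<lambda>h. a * h + b * cnj h)) (at w)"
    and "(g has_derivative (\<lambda>h. c * h + d * cnj h)) (at w)"
  shows "((\<lambda>w. f w * g w) has_derivative
    (\<lambda>h. (a * g w + f w * c) * h + (b * g w + f w * d) * cnj h)) (at w)"
  by (rule has_derivative_eq_rhs[OF has_derivative_mult[OF assms]]) (simp add: fun_eq_iff algebra_simps)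

lemma has_derivative_wirtinger_holomorphic:
  "(f has_field_derivative d) (at w) \<Longrightarrow> (f has_derivative (\<lambda>h. d * h + 0 * cnj h)) (at w)"
  by (simp add: has_field_derivative_def)

lemma has_derivative_wirtinger_cnj:
  assumes "(f has_derivative (\<lambda>h. a * h + b * cnj h)) (at w)"
  shows "((\<lambda>w. cnj (f w)) has_derivative (\<lambda>h. cnj b * h + cnj a * cnj h)) (at w)"
  by (rule has_derivative_eq_rhs[OF has_derivative_cnj[OF assms]]) (simp add: fun_eq_iff)

lemma has_derivative_wirtinger_compose:
  assumes "(f has_derivative (\<lambda>h. a * h + b * cnj h)) (at w)"
    and "(\<phi> has_field_derivative d) (at (f w))"
  shows "((\<lambda>w. \<phi> (f w)) has_derivative (\<lambda>h. (d * a) * h + (d * b) * cnj h)) (at w)"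
  by (rule has_derivative_eq_rhs[OF has_derivative_compose[OF assms(1) assms(2)[unfolded has_field_derivative_def]]])
    (simp add: fun_eq_iff algebra_simps)

lemma has_derivative_wirtinger_add:
  assumes "(f has_derivative (\<lambda>h. a * h + b * cnj h)) (at w)"
    and "(g has_derivative (\<lambda>h. c * h + d * cnj h)) (at w)"
  shows "((\<lambda>w. f w + g w) has_derivative (\<lambda>h. (a + c) * h + (b + d) * cnj h)) (at w)"
  by (rule has_derivative_eq_rhs[OF has_derivative_add[OF assms]]) (simp add: fun_eq_iff algebra_simps)

lemma has_derivative_wirtinger_norm_square:
  assumes "(f has_field_derivative d) (at w)"
  shows "((\<lambda>w. f w * cnj (f w)) has_derivative (\<lambda>h. (d * cnj (f w)) * h + (f w * cnj d) * cnj h)) (at w)"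
  using has_derivative_wirtinger_mult[OF has_derivative_wirtinger_holomorphic[OF assms]
      has_derivative_wirtinger_cnj[OF has_derivative_wirtinger_holomorphic[OF assms]]]
  by simp

text \<open>The integral of the difference quotient in direction \<open>v\<close> vanishes by translation invariance of
  Lebesgue measure; compactness of the support allows passing to the limit.\<close>

lemma has_bochner_integral_directional_derivative:
  fixes f :: "complex \<Rightarrow> complex"
  assumes deriv: "\<And>w. (f has_derivative f' w) (at w)"
    and cont: "continuous_on UNIV (\<lambda>w. f' w v)"
    and supp: "\<And>w. w \<notin> cball 0 R \<Longrightarrow> f w = 0"
  shows "has_bochner_integral lborel (\<lambda>w. f' w v) 0"
proof -
  have cf: "continuous_on UNIV f"
    using deriv by (meson continuous_at_imp_continuous_on has_derivative_continuous)
  note [measurable] = borel_measurable_continuous_onI[OF cf] borel_measurable_continuous_onI[OF cont]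
  have f'0: "f' u v = 0" if "u \<notin> cball 0 R" for u
  proof -
    have "\<forall>\<^sub>F x in nhds u. f x = 0"
      using that by (intro eventually_nhds[THEN iffD2] exI[of _ "- cball 0 R"]) (auto intro: supp)
    then have "\<forall>\<^sub>F x in at u. f x = 0"
      by (simp add: eventually_at_filter eventually_mono)
    then have "((\<lambda>x. 0) has_derivative f' u) (at u)"
      using supp[OF that] by (intro has_derivative_transform_eventually[OF deriv]) auto
    then have "f' u = (\<lambda>h. 0)"
      by (rule has_derivative_unique) simp
    then show ?thesis by simp
  qed
  have int': "integrable lborel (\<lambda>w. f' w v)"
  proof -
    have "integrable lborel (\<lambda>w. indicator (cball 0 R) w *\<^sub>R f' w v)"
      by (rule borel_integrable_compact) (auto intro: continuous_on_subset[OF cont])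
    also have "(\<lambda>w. indicator (cball 0 R) w *\<^sub>R f' w v) = (\<lambda>w. f' w v)"
      using f'0 by (auto simp: indicator_def fun_eq_iff)
    finally show ?thesis .
  qed
  let ?B = "cball 0 (R + norm v) :: complex set"
  have "compact ((\<lambda>w. f' w v) ` ?B)"
    by (intro compact_continuous_image continuous_on_subset[OF cont]) auto
  then obtain C where C: "\<And>w. w \<in> ?B \<Longrightarrow> norm (f' w v) \<le> C"
    by (meson bounded_iff compact_imp_bounded imageI)
  define \<epsilon> where "\<epsilon> n = inverse (real (Suc n))" for n
  have \<epsilon>: "0 < \<epsilon> n" "\<epsilon> n \<le> 1" for n
    by (auto simp: \<epsilon>_def field_simps)
  have lim\<epsilon>: "\<epsilon> \<longlonglongrightarrow> 0"
    unfolding \<epsilon>_def by (rule LIMSEQ_inverse_real_of_nat)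
  define D where "D n w = (f (w + \<epsilon> n *\<^sub>R v) - f w) /\<^sub>R \<epsilon> n" for n w
  have dline: "((\<lambda>t. f (w + t *\<^sub>R v)) has_derivative (\<lambda>t. t *\<^sub>R f' (w + s *\<^sub>R v) v)) (at s within X)" for w s X
  proof -
    have "((\<lambda>t. f (w + t *\<^sub>R v)) has_derivative (\<lambda>t. f' (w + s *\<^sub>R v) (t *\<^sub>R v))) (at s within X)"
      by (rule has_derivative_compose[OF _ deriv]) (auto intro!: derivative_eq_intros)
    then show ?thesis
      using has_derivative_linear[OF deriv[of "w + s *\<^sub>R v"]] by (simp add: linear_cmul)
  qed
  have fint: "integrable lborel f"
  proof -
    have "integrable lborel (\<lambda>w. indicator (cball 0 R) w *\<^sub>R f w)"
      by (rule borel_integrable_compact) (auto intro: continuous_on_subset[OF cf])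
    also have "(\<lambda>w. indicator (cball 0 R) w *\<^sub>R f w) = f"
      using supp by (auto simp: indicator_def fun_eq_iff)
    finally show ?thesis .
  qed
  have transl: "integrable lborel (\<lambda>w. f (w + u))" "(\<integral>w. f (w + u) \<partial>lborel) = (\<integral>w. f w \<partial>lborel)" for u
  proof -
    have "integrable (distr lborel borel ((+) u)) f"
      using fint by (simp add: lborel_distr_plus)
    then show "integrable lborel (\<lambda>w. f (w + u))"
      by (subst (asm) integrable_distr_eq) (auto simp: add.commute)
    have "(\<integral>w. f w \<partial>lborel) = (\<integral>w. f w \<partial>distr lborel borel ((+) u))"
      by (simp add: lborel_distr_plus)
    also have "\<dots> = (\<integral>w. f (w + u) \<partial>lborel)"
      by (subst integral_distr) (auto simp: add.commute)
    finally show "(\<integral>w. f (w + u) \<partial>lborel) = (\<integral>w. f w \<partial>lborel)" ..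
  qed
  have "(\<lambda>n. \<integral>w. D n w \<partial>lborel) \<longlonglongrightarrow> (\<integral>w. f' w v \<partial>lborel)"
  proof (rule integral_dominated_convergence[where w = "\<lambda>w. indicator ?B w *\<^sub>R C"])
    show "(\<lambda>w. f' w v) \<in> borel_measurable lborel" "D n \<in> borel_measurable lborel" for n
      unfolding D_def by measurable
    show "integrable lborel (\<lambda>w. indicator ?B w *\<^sub>R C)"
      by (rule borel_integrable_compact) auto
    show "AE w in lborel. (\<lambda>n. D n w) \<longlonglongrightarrow> f' w v"
    proof (rule AE_I2)
      fix w
      have "((\<lambda>t. f (w + t *\<^sub>R v)) has_vector_derivative f' w v) (at 0)"
        using dline[of w 0 UNIV] by (simp add: has_vector_derivative_def)
      then have "((\<lambda>t. norm (f (w + t *\<^sub>R v) - f w - t *\<^sub>R f' w v) / norm t) \<longlongrightarrow> 0) (at 0)"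
        by (simp add: has_vector_derivative_def has_derivative_at)
      moreover have "\<forall>\<^sub>F t in at 0. norm (f (w + t *\<^sub>R v) - f w - t *\<^sub>R f' w v) / norm t
          = norm ((f (w + t *\<^sub>R v) - f w) /\<^sub>R t - f' w v)"
      proof -
        have "norm (x - t *\<^sub>R y) / norm t = norm (x /\<^sub>R t - y)" if "t \<noteq> 0" for t :: real and x y :: complex
        proof -
          have "x /\<^sub>R t - y = (x - t *\<^sub>R y) /\<^sub>R t"
            using that by (simp add: scaleR_diff_right)
          then show ?thesis
            by (simp add: divide_inverse mult.commute)
        qed
        then show ?thesis
          by (simp add: eventually_at_filter)
      qed
      ultimately have "((\<lambda>t. norm ((f (w + t *\<^sub>R v) - f w) /\<^sub>R t - f' w v)) \<longlongrightarrow> 0) (at 0)"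
        by (rule Lim_transform_eventually)
      then have "((\<lambda>t. (f (w + t *\<^sub>R v) - f w) /\<^sub>R t) \<longlongrightarrow> f' w v) (at 0)"
        by (rule LIM_zero_cancel[OF tendsto_norm_zero_cancel])
      moreover have "filterlim \<epsilon> (at 0) sequentially"
        using lim\<epsilon> \<epsilon>(1) by (simp add: filterlim_at less_imp_neq[symmetric])
      ultimately show "(\<lambda>n. D n w) \<longlonglongrightarrow> f' w v"
        unfolding D_def by (rule filterlim_compose)
    qed
    show "AE w in lborel. norm (D n w) \<le> indicator ?B w *\<^sub>R C" for n
    proof (rule AE_I2)
      fix w
      show "norm (D n w) \<le> indicator ?B w *\<^sub>R C"
      proof (cases "w \<in> ?B")
        case False
        have "norm w \<le> norm (w + \<epsilon> n *\<^sub>R v) + norm (\<epsilon> n *\<^sub>R v)"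
          by (metis add_diff_cancel norm_triangle_ineq4)
        moreover have "norm (\<epsilon> n *\<^sub>R v) \<le> norm v"
          using \<epsilon>[of n] by (simp add: mult_left_le_one_le)
        ultimately have "f w = 0" "f (w + \<epsilon> n *\<^sub>R v) = 0"
          using False norm_ge_zero[of v] by (auto intro!: supp simp del: norm_ge_zero)
        with False show ?thesis by (simp add: D_def)
      next
        case True
        have bnd: "norm (f' u v) \<le> C" for u
          using C[of u] f'0[of u] add_increasing2[OF norm_ge_zero[of v], of "norm u" R]
            order_trans[OF norm_ge_zero C[OF True]]
          by (cases "u \<in> cball 0 R") auto
        have "norm (f (w + \<epsilon> n *\<^sub>R v) - f (w + 0 *\<^sub>R v)) \<le> C * norm (\<epsilon> n - 0)"
        proof (rule differentiable_bound[where S = UNIV])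
          show "((\<lambda>t. f (w + t *\<^sub>R v)) has_derivative (\<lambda>t. t *\<^sub>R f' (w + s *\<^sub>R v) v)) (at s within UNIV)" for s
            by (rule dline)
          show "onorm (\<lambda>t. t *\<^sub>R f' (w + s *\<^sub>R v) v) \<le> C" for s
            using bnd[of "w + s *\<^sub>R v"] by (intro onorm_le) (simp add: mult.commute[of C] mult_left_mono)
        qed auto
        then show ?thesis
          using True \<epsilon>[of n] by (simp add: D_def pos_divide_le_eq divide_inverse_commute[symmetric])
      qed
    qed
  qed
  moreover have "(\<integral>w. D n w \<partial>lborel) = 0" for n
    unfolding D_def using transl fint by simp
  ultimately have "(\<integral>w. f' w v \<partial>lborel) = 0"
    by (simp add: LIMSEQ_const_iff)
  with int' show ?thesis
    by (simp add: has_bochner_integral_iff)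
qed

lemma has_real_derivative_square_positive_part:
  "((\<lambda>x::real. (max 0 x)\<^sup>2) has_real_derivative 2 * max 0 x) (at x)"
proof -
  consider "x > 0" | "x < 0" | "x = 0" by linarith
  then show ?thesis
  proof cases
    case 1
    have "((\<lambda>x::real. x\<^sup>2) has_real_derivative 2 * max 0 x) (at x)"
      using 1 by (auto intro!: derivative_eq_intros)
    then show ?thesis
      by (rule DERIV_cong_ev[THEN iffD1, rotated -1])
        (use 1 eventually_nhds_in_open[of "{0<..}" x] in \<open>auto elim!: eventually_mono\<close>)
  next
    case 2
    have "((\<lambda>x::real. 0) has_real_derivative 2 * max 0 x) (at x)"
      using 2 by (auto intro!: derivative_eq_intros)
    then show ?thesis
      by (rule DERIV_cong_ev[THEN iffD1, rotated -1])
        (use 2 eventually_nhds_in_open[of "{..<0}" x] in \<open>auto elim!: eventually_mono\<close>)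
  next
    case 3
    have "((\<lambda>h::real. (max 0 h)\<^sup>2 / h) \<longlongrightarrow> 0) (at 0)"
    proof (rule tendsto_norm_zero_cancel, rule tendsto_sandwich[of "\<lambda>_. 0" _ _ "\<lambda>h. \<bar>h\<bar>"])
      show "\<forall>\<^sub>F h::real in at 0. norm ((max 0 h)\<^sup>2 / h) \<le> \<bar>h\<bar>"
        by (auto simp: power2_eq_square max_def)
      show "((\<lambda>h::real. \<bar>h\<bar>) \<longlongrightarrow> 0) (at 0)"
        by (intro tendsto_rabs_zero tendsto_ident_at)
    qed auto
    then show ?thesis
      using 3 by (simp add: DERIV_def)
  qed
qed

text \<open>Stokes' theorem for \<open>f dw\<close> on the whole plane. The boundary term at infinity is controlled by
  the integrability of \<open>f\<close>, by means of the cutoffs \<open>(max 0 (1 - |w|\<^sup>2 / r\<^sup>2))\<^sup>2\<close>: they are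
  continuously differentiable, and their gradients are bounded and tend to \<open>0\<close>.\<close>

lemma integral_dbar_eq_0:
  fixes f a b :: "complex \<Rightarrow> complex"
  assumes deriv: "\<And>w. (f has_derivative (\<lambda>h. a w * h + b w * cnj h)) (at w)"
    and conta: "continuous_on UNIV a" and contb: "continuous_on UNIV b"
    and f: "integrable lborel f" and b: "integrable lborel b"
  shows "(\<integral>w. b w \<partial>lborel) = 0"
proof -
  define r where "r n = real (Suc n)" for n
  have r: "r n > 0" "r n \<ge> 1" for n by (simp_all add: r_def)
  have rlim: "filterlim r at_top sequentially"
    unfolding r_def by (rule filterlim_compose[OF filterlim_real_sequentially filterlim_Suc])
  define m where "m n w = max 0 (1 - (cmod w)\<^sup>2 / (r n)\<^sup>2)" for n w
  define \<eta> where "\<eta> n w = complex_of_real ((m n w)\<^sup>2)" for n w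
  define \<eta>a where "\<eta>a n w = - (2 * of_real (m n w) / of_real ((r n)\<^sup>2)) * cnj w" for n w
  define \<eta>b where "\<eta>b n w = - (2 * of_real (m n w) / of_real ((r n)\<^sup>2)) * w" for n w
  have m: "0 \<le> m n w" "m n w \<le> 1" for n w
    by (auto simp: m_def)
  have m0: "m n w = 0" if "w \<notin> cball 0 (r n)" for n w
  proof -
    have "(r n)\<^sup>2 \<le> (cmod w)\<^sup>2"
      using that r(1)[of n] by (intro power_mono) auto
    then show ?thesis using r(1)[of n] by (simp add: m_def divide_simps)
  qed
  have contm: "continuous_on UNIV (m n)" for n
    unfolding m_def using r(1)[of n] by (auto intro!: continuous_intros)
  have d\<eta>: "(\<eta> n has_derivative (\<lambda>h. \<eta>a n w * h + \<eta>b n w * cnj h)) (at w)" for n w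
  proof -
    have "((\<lambda>w. 1 - (cmod w)\<^sup>2 / (r n)\<^sup>2) has_derivative (\<lambda>h. - (2 * (w \<bullet> h)) / (r n)\<^sup>2)) (at w)"
      unfolding power2_norm_eq_inner using r(1)[of n]
      by (auto intro!: derivative_eq_intros simp: inner_commute fun_eq_iff divide_simps power4_eq_xxxx power2_eq_square)
    from has_derivative_compose[OF this has_field_derivative_imp_has_derivative[OF has_real_derivative_square_positive_part]]
    have "((\<lambda>w. (m n w)\<^sup>2) has_derivative (\<lambda>h. 2 * m n w * (- (2 * (w \<bullet> h)) / (r n)\<^sup>2))) (at w)"
      by (simp add: m_def)
    from has_derivative_of_real[OF this]
    have "(\<eta> n has_derivative (\<lambda>h. of_real (2 * m n w * (- (2 * (w \<bullet> h)) / (r n)\<^sup>2)))) (at w)"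
      unfolding \<eta>_def[abs_def] .
    moreover have "complex_of_real (2 * (w \<bullet> h)) = cnj w * h + w * cnj h" for h
      by (simp add: complex_eq_iff inner_complex_def)
    then have "of_real (2 * m n w * (- (2 * (w \<bullet> h)) / (r n)\<^sup>2)) = \<eta>a n w * h + \<eta>b n w * cnj h" for h
    proof -
      define K where "K = - (2 * complex_of_real (m n w) / of_real ((r n)\<^sup>2))"
      have "of_real (2 * m n w * (- (2 * (w \<bullet> h)) / (r n)\<^sup>2)) = K * complex_of_real (2 * (w \<bullet> h))"
        by (simp add: K_def)
      also have "\<dots> = K * (cnj w * h + w * cnj h)"
        by (simp only: \<open>\<And>h. complex_of_real (2 * (w \<bullet> h)) = cnj w * h + w * cnj h\<close>)
      also have "\<dots> = \<eta>a n w * h + \<eta>b n w * cnj h"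
        unfolding \<eta>a_def \<eta>b_def K_def[symmetric] by (simp add: algebra_simps)
      finally show ?thesis .
    qed
    ultimately show ?thesis by simp
  qed
  define A where "A n w = a w * \<eta> n w + f w * \<eta>a n w" for n w
  define B where "B n w = b w * \<eta> n w + f w * \<eta>b n w" for n w
  have d: "((\<lambda>w. f w * \<eta> n w) has_derivative (\<lambda>h. A n w * h + B n w * cnj h)) (at w)" for n w
    unfolding A_def B_def by (rule has_derivative_wirtinger_mult[OF deriv d\<eta>])
  have contf: "continuous_on UNIV f"
    using deriv by (meson continuous_at_imp_continuous_on has_derivative_continuous)
  have contAB: "continuous_on UNIV (A n)" "continuous_on UNIV (B n)" for n
    unfolding A_def B_def \<eta>_def \<eta>a_def \<eta>b_def
    by (intro continuous_intros conta contb contf contm; use r(1)[of n] in simp)+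
  have AB: "has_bochner_integral lborel (\<lambda>w. A n w * v + B n w * cnj v) 0" for n v
    by (rule has_bochner_integral_directional_derivative[OF d, where R = "r n"])
      (auto intro!: continuous_intros contAB simp: \<eta>_def m0)
  \<comment> \<open>The derivatives in the directions \<open>1\<close> and \<open>\<i>\<close> are \<open>A + B\<close> and \<open>\<i> * (A - B)\<close>; they determine \<open>B\<close>.\<close>
  have "has_bochner_integral lborel (\<lambda>w. ((A n w * 1 + B n w * cnj 1) + \<i> * (A n w * \<i> + B n w * cnj \<i>)) / 2)
      ((0 + \<i> * 0) / 2)" for n
    by (intro has_bochner_integral_divide has_bochner_integral_add has_bochner_integral_mult_right AB)
  then have IB: "has_bochner_integral lborel (B n) 0" for n
    by (simp add: algebra_simps)
  have "(\<lambda>n. \<integral>w. B n w \<partial>lborel) \<longlonglongrightarrow> (\<integral>w. b w \<partial>lborel)"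
  proof (rule integral_dominated_convergence[where w = "\<lambda>w. norm (b w) + 2 * norm (f w)"])
    show "b \<in> borel_measurable lborel" "B n \<in> borel_measurable lborel" for n
      using borel_measurable_continuous_onI[OF contb] borel_measurable_continuous_onI[OF contAB(2)] by auto
    show "integrable lborel (\<lambda>w. norm (b w) + 2 * norm (f w))"
      using f b by (intro Bochner_Integration.integrable_add integrable_mult_right integrable_norm)
    have rinf: "(\<lambda>n. c / (r n)\<^sup>2) \<longlonglongrightarrow> 0" for c :: real
      by (intro real_tendsto_divide_at_top[where F = sequentially] tendsto_const
          filterlim_pow_at_top rlim) auto
    have mlim: "(\<lambda>n. m n w) \<longlonglongrightarrow> 1" for w
      using tendsto_max[OF tendsto_const[of 0] tendsto_diff[OF tendsto_const[of 1] rinf[of "(cmod w)\<^sup>2"]]]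
      by (simp add: m_def)
    show "AE w in lborel. (\<lambda>n. B n w) \<longlonglongrightarrow> b w"
    proof (rule AE_I2)
      fix w
      have "(\<lambda>n. b w * of_real ((m n w)\<^sup>2) + f w * (- (of_real (2 * m n w * (1 / (r n)\<^sup>2))) * w))
          \<longlonglongrightarrow> b w * of_real (1\<^sup>2) + f w * (- (of_real (2 * 1 * 0)) * w)"
        by (intro tendsto_intros mlim rinf)
      then show "(\<lambda>n. B n w) \<longlonglongrightarrow> b w"
        by (simp add: B_def \<eta>_def \<eta>b_def)
    qed
    show "AE w in lborel. norm (B n w) \<le> norm (b w) + 2 * norm (f w)" for n
    proof (rule AE_I2)
      fix w
      have 1: "norm (\<eta> n w) \<le> 1"
        using m[of n w] by (simp add: \<eta>_def norm_power power_le_one)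
      have 2: "norm (\<eta>b n w) \<le> 2"
      proof (cases "w \<in> cball 0 (r n)")
        case True
        then have "cmod w \<le> r n" by simp
        also have "r n \<le> (r n)\<^sup>2" using r(2)[of n] by (simp add: power2_eq_square)
        finally have "m n w * cmod w \<le> 1 * (r n)\<^sup>2"
          using m[of n w] by (intro mult_mono) auto
        then show ?thesis
          using m[of n w] r(1)[of n] by (simp add: \<eta>b_def norm_mult norm_divide norm_power divide_simps)
      qed (simp add: \<eta>b_def m0)
      have "norm (B n w) \<le> norm (b w) * norm (\<eta> n w) + norm (f w) * norm (\<eta>b n w)"
        unfolding B_def by (metis norm_mult norm_triangle_ineq)
      also have "\<dots> \<le> norm (b w) * 1 + norm (f w) * 2"
        using 1 2 by (intro add_mono mult_left_mono) auto
      finally show "norm (B n w) \<le> norm (b w) + 2 * norm (f w)" by simp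
    qed
  qed
  moreover have "(\<integral>w. B n w \<partial>lborel) = 0" for n
    using IB by (simp add: has_bochner_integral_iff)
  ultimately show ?thesis
    by (simp add: LIMSEQ_const_iff)
qed

section \<open>The area of the graph in a Gaussian window\<close>

lemma poly_growth_upper:
  fixes p :: "complex poly"
  obtains C where "0 < C" "\<And>w. cmod (poly p w) \<le> C * (1 + cmod w) ^ degree p"
proof (rule that[of "1 + (\<Sum>i\<le>degree p. cmod (coeff p i))"])
  show "0 < 1 + (\<Sum>i\<le>degree p. cmod (coeff p i))"
    by (intro add_pos_nonneg sum_nonneg) auto
  fix w
  have "cmod (poly p w) \<le> (\<Sum>i\<le>degree p. cmod (coeff p i) * cmod w ^ i)"
    unfolding poly_altdef by (rule order_trans[OF norm_sum]) (simp add: norm_mult norm_power)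
  also have "\<dots> \<le> (\<Sum>i\<le>degree p. cmod (coeff p i) * (1 + cmod w) ^ degree p)"
  proof (intro sum_mono mult_left_mono)
    fix i assume "i \<in> {..degree p}"
    then have "cmod w ^ i \<le> (1 + cmod w) ^ i" "(1 + cmod w) ^ i \<le> (1 + cmod w) ^ degree p"
      by (auto intro!: power_mono power_increasing)
    then show "cmod w ^ i \<le> (1 + cmod w) ^ degree p" by linarith
  qed auto
  also have "\<dots> \<le> (1 + (\<Sum>i\<le>degree p. cmod (coeff p i))) * (1 + cmod w) ^ degree p"
    by (simp add: sum_distrib_right distrib_right)
  finally show "cmod (poly p w) \<le> (1 + (\<Sum>i\<le>degree p. cmod (coeff p i))) * (1 + cmod w) ^ degree p" .
qed

text \<open>Outside a large disc the leading term is at least twice the rest of the polynomial.\<close>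

lemma poly_growth_lower:
  fixes p :: "complex poly"
  assumes "p \<noteq> 0"
  obtains C where "0 < C" "\<And>w. (1 + cmod w) ^ degree p \<le> C * (1 + cmod (poly p w))"
proof (cases "degree p")
  case 0
  then show ?thesis by (intro that[of 1]) auto
next
  case (Suc n)
  define l where "l = cmod (lead_coeff p)"
  have l: "l > 0" using assms by (simp add: l_def)
  obtain M where M: "\<And>z. M \<le> norm z \<Longrightarrow> norm (\<Sum>i\<le>n. coeff p i * z ^ i) \<le> l / 2 * norm z ^ Suc n"
    using polyfun_extremal_lemma[of "l / 2" "coeff p" n] l by auto
  define R where "R = max M 1"
  show ?thesis
  proof (rule that[of "2 ^ Suc n * (2 / l) + (1 + R) ^ Suc n"])
    show pos: "0 < 2 ^ Suc n * (2 / l) + (1 + R) ^ Suc n"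
      using l by (intro add_pos_pos) (auto simp: R_def)
    fix w
    have "(1 + cmod w) ^ Suc n \<le> 2 ^ Suc n * (2 / l) * cmod (poly p w) + (1 + R) ^ Suc n"
    proof (cases "R \<le> cmod w")
      case True
      have "poly p w = (\<Sum>i\<le>n. coeff p i * w ^ i) + lead_coeff p * w ^ Suc n"
        by (simp add: poly_altdef Suc)
      then have "l * cmod w ^ Suc n \<le> cmod (poly p w) + norm (\<Sum>i\<le>n. coeff p i * w ^ i)"
        by (metis add_diff_cancel_left' l_def norm_mult norm_power norm_triangle_ineq4)
      with M[of w] True have "l / 2 * cmod w ^ Suc n \<le> cmod (poly p w)"
        by (simp add: R_def)
      then have "2 ^ Suc n * cmod w ^ Suc n \<le> 2 ^ Suc n * (2 / l) * cmod (poly p w)"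
        using l by (simp add: field_simps)
      moreover have "(1 + cmod w) ^ Suc n \<le> (2 * cmod w) ^ Suc n"
        using True by (intro power_mono) (auto simp: R_def)
      ultimately have "(1 + cmod w) ^ Suc n \<le> 2 ^ Suc n * (2 / l) * cmod (poly p w)"
        by (simp only: power_mult_distrib)
      moreover have "0 \<le> (1 + R) ^ Suc n" by (simp add: R_def)
      ultimately show ?thesis by linarith
    next
      case False
      then have "(1 + cmod w) ^ Suc n \<le> (1 + R) ^ Suc n"
        by (intro power_mono) auto
      moreover have "0 \<le> 2 ^ Suc n * (2 / l) * cmod (poly p w)"
        using l by simp
      ultimately show ?thesis by linarith
    qed
    also have "\<dots> \<le> (2 ^ Suc n * (2 / l) + (1 + R) ^ Suc n) * (1 + cmod (poly p w))"
    proof -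
      have "0 \<le> 2 ^ Suc n * (2 / l)" "0 \<le> (1 + R) ^ Suc n * cmod (poly p w)"
        using l by (auto simp: R_def)
      then show ?thesis by (simp add: distrib_left distrib_right)
    qed
    finally show "(1 + cmod w) ^ degree p \<le> (2 ^ Suc n * (2 / l) + (1 + R) ^ Suc n) * (1 + cmod (poly p w))"
      by (simp add: Suc)
  qed
qed

text \<open>The logarithmic derivative \<open>Q' / Q\<close> at \<open>w\<close> is the sum of the \<open>1 / (w - r)\<close> over the roots \<open>r\<close> of \<open>Q\<close>,
  so it is at most \<open>degree Q\<close> divided by the distance to the nearest root.\<close>

lemma dist_roots_times_pderiv_le:
  fixes Q :: "complex poly"
  assumes "\<And>r. poly Q r = 0 \<Longrightarrow> \<rho> \<le> cmod (w - r)" "0 \<le> \<rho>"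
  shows "\<rho> * cmod (poly (pderiv Q) w) \<le> real (degree Q) * cmod (poly Q w)"
  using assms(1)
proof (induction "degree Q" arbitrary: Q)
  case 0
  then show ?case
    by (metis degree_pderiv diff_0_eq_0 mult_zero_left mult_zero_right norm_zero of_nat_0 order_refl
        pderiv_eq_0_iff poly_0)
next
  case (Suc n)
  then obtain a where a: "poly Q a = 0"
    using alg_closed_imp_poly_has_root[of Q] by auto
  then obtain Q1 where Q: "Q = [:- a, 1:] * Q1"
    by (auto simp: poly_eq_0_iff_dvd)
  have Q1: "Q1 \<noteq> 0" using Suc(2) Q by auto
  have deg: "degree Q = Suc (degree Q1)"
    unfolding Q using Q1 by (subst degree_mult_eq) auto
  have IH: "\<rho> * cmod (poly (pderiv Q1) w) \<le> real (degree Q1) * cmod (poly Q1 w)"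
    using Suc deg by (intro Suc(1)) (auto simp: Q)
  have "poly (pderiv Q) w = poly Q1 w + (w - a) * poly (pderiv Q1) w"
    unfolding Q pderiv_mult by (simp add: pderiv_pCons algebra_simps)
  then have "cmod (poly (pderiv Q) w) \<le> cmod (poly Q1 w) + cmod (w - a) * cmod (poly (pderiv Q1) w)"
    by (metis norm_mult norm_triangle_ineq)
  then have "\<rho> * cmod (poly (pderiv Q) w) \<le> \<rho> * (cmod (poly Q1 w) + cmod (w - a) * cmod (poly (pderiv Q1) w))"
    using assms(2) by (rule mult_left_mono)
  also have "\<dots> = \<rho> * cmod (poly Q1 w) + cmod (w - a) * (\<rho> * cmod (poly (pderiv Q1) w))"
    by (simp add: algebra_simps)
  also have "\<dots> \<le> cmod (w - a) * cmod (poly Q1 w) + cmod (w - a) * (real (degree Q1) * cmod (poly Q1 w))"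
    using IH Suc(3)[OF a] by (intro add_mono mult_right_mono mult_left_mono) auto
  also have "\<dots> = real (degree Q) * cmod (poly Q w)"
    unfolding deg by (simp add: Q norm_mult distrib_right distrib_left mult_ac flip: left_diff_distrib)
  finally show ?case .
qed

text \<open>Up to constants this is \<open>1 + |P'|\<close>, but unlike \<open>|P'|\<close> it varies slowly: it changes at most by a
  constant factor on discs of radius \<open>1\<close>.\<close>

definition slope_weight :: "complex poly \<Rightarrow> complex \<Rightarrow> real" where
  "slope_weight P w = (1 + cmod w) ^ (degree P - 1)"

lemma slope_weight_ge_1: "1 \<le> slope_weight P w"
  by (simp add: slope_weight_def)

lemma slope_weight_mono_dist:
  "slope_weight P w \<le> (1 + cmod (w - z)) ^ (degree P - 1) * slope_weight P z"
proof -
  have "1 + cmod w \<le> (1 + cmod (w - z)) * (1 + cmod z)"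
    using norm_triangle_ineq[of "w - z" z, unfolded diff_add_cancel] mult_nonneg_nonneg[OF norm_ge_zero[of "w - z"] norm_ge_zero[of z]]
    by (simp only: distrib_left distrib_right mult_1_left mult_1_right)
  then show ?thesis
    by (simp add: slope_weight_def power_mono flip: power_mult_distrib)
qed

lemma slope_weight_lower:
  obtains A where "0 < A" "\<And>w. slope_weight P w \<le> A * (1 + cmod (poly (pderiv P) w))"
proof (cases "degree P")
  case 0
  then show ?thesis by (intro that[of 1]) (auto simp: slope_weight_def)
next
  case (Suc n)
  then have "pderiv P \<noteq> 0"
    by (simp add: pderiv_eq_0_iff)
  then obtain A where "0 < A" "\<And>w. (1 + cmod w) ^ degree (pderiv P) \<le> A * (1 + cmod (poly (pderiv P) w))"
    using poly_growth_lower by blast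
  then show ?thesis by (intro that[of A]) (auto simp: slope_weight_def degree_pderiv)
qed

lemma slope_weight_upper:
  obtains A where "0 < A" "\<And>w. cmod (poly (pderiv P) w) \<le> A * slope_weight P w"
  using poly_growth_upper[of "pderiv P"] by (metis slope_weight_def degree_pderiv)

lemma add_square_le: "(x + y)\<^sup>2 \<le> 2 * (x\<^sup>2 + y\<^sup>2)" for x y :: real
  using zero_le_power2[of "x - y"] by (simp add: power2_eq_square algebra_simps)

lemma degree_diff_pCons_0: "0 < degree p \<Longrightarrow> degree (p - [:c:]) = degree p" for p :: "'a::ab_group_add poly"
  unfolding diff_conv_add_uminus by (rule degree_add_eq_left) simp

text \<open>Let \<open>r\<close> be the solution of \<open>P r = \<zeta>\<close> that is nearest to \<open>w\<close>. The bound on the logarithmic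
  derivative gives \<open>|P w - \<zeta>| \<ge> |P' w| |w - r| / degree P\<close>. If \<open>r\<close> is further away than \<open>1\<close>, the
  Gaussian in \<open>P w - \<zeta>\<close> beats the weight. Otherwise the weights at \<open>w\<close> and \<open>r\<close> are comparable, and
  the Gaussian in \<open>P w - \<zeta>\<close> is dominated by one in \<open>w - r\<close> whose width is inverse to the weight. The
  sum over all solutions serves to make the right-hand side an explicit function of \<open>w\<close>.\<close>

lemma slope_weight_gaussian_bound:
  fixes P :: "complex poly"
  assumes "degree P > 0"
  obtains C \<kappa> where "0 \<le> C" "0 < \<kappa>"
    "\<And>w \<zeta>. (slope_weight P w)\<^sup>2 * exp (- (cmod (poly P w - \<zeta>))\<^sup>2 / 4) \<le>
      C + C * (\<Sum>r | poly P r = \<zeta>. (slope_weight P r)\<^sup>2 * exp (- \<kappa> * (slope_weight P r)\<^sup>2 * (cmod (w - r))\<^sup>2))"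
proof -
  let ?N = "slope_weight P"
  define d where "d = real (degree P)"
  have d: "1 \<le> d" using assms by (simp add: d_def)
  define b where "b = (2::real) ^ (degree P - 1)"
  have b: "1 \<le> b" by (simp add: b_def)
  obtain A where A: "0 < A" "\<And>w. ?N w \<le> A * (1 + cmod (poly (pderiv P) w))"
    using slope_weight_lower by blast
  define \<kappa> where "\<kappa> = 1 / (8 * A\<^sup>2 * b\<^sup>2 * d\<^sup>2)"
  define C where "C = max (2 * A\<^sup>2 * (1 + 4 * d\<^sup>2)) (exp 1 * b\<^sup>2)"
  show ?thesis
  proof (rule that[of C \<kappa>])
    show C0: "0 \<le> C" by (simp add: C_def le_max_iff_disj)
    show "0 < \<kappa>" using A(1) b d by (simp add: \<kappa>_def)
    fix w \<zeta>
    define Q where "Q = P - [:\<zeta>:]"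
    have Q: "poly Q x = poly P x - \<zeta>" "pderiv Q = pderiv P" "degree Q = degree P" for x
      using assms by (auto simp: Q_def pderiv_diff pderiv_pCons degree_diff_pCons_0)
    have Qn: "Q \<noteq> 0" using Q(3) assms by auto
    define Z where "Z = {r. poly P r = \<zeta>}"
    have Z: "Z = {r. poly Q r = 0}" by (auto simp: Z_def Q)
    have finZ: "finite Z" unfolding Z using Qn by (rule poly_roots_finite)
    have neZ: "Z \<noteq> {}" unfolding Z using alg_closed_imp_poly_has_root[of Q] assms Q(3) by auto
    obtain r where r: "r \<in> Z" "\<And>s. s \<in> Z \<Longrightarrow> cmod (w - r) \<le> cmod (w - s)"
      using arg_min_least[OF finZ neZ, of _ "\<lambda>s. cmod (w - s)"] arg_min_if_finite(1)[OF finZ neZ, of "\<lambda>s. cmod (w - s)"] by blast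
    define \<rho> where "\<rho> = cmod (w - r)"
    define t where "t = cmod (poly P w - \<zeta>)"
    define p where "p = cmod (poly (pderiv P) w)"
    have \<rho>p: "\<rho> * p \<le> d * t"
      using dist_roots_times_pderiv_le[of Q \<rho> w] r(2) by (simp add: \<rho>_def t_def p_def d_def Z Q)
    have nn: "0 \<le> \<rho>" "0 \<le> t" "0 \<le> p" by (auto simp: \<rho>_def t_def p_def)
    let ?S = "\<Sum>r\<in>Z. (?N r)\<^sup>2 * exp (- \<kappa> * (?N r)\<^sup>2 * (cmod (w - r))\<^sup>2)"
    have S0: "0 \<le> ?S" by (intro sum_nonneg) auto
    have N2: "(?N w)\<^sup>2 \<le> 2 * A\<^sup>2 * (1 + p\<^sup>2)"
    proof -
      have "(?N w)\<^sup>2 \<le> (A * (1 + p))\<^sup>2"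
        using A(2)[of w] slope_weight_ge_1[of P w] by (intro power_mono) (auto simp: p_def)
      also have "\<dots> \<le> A\<^sup>2 * (2 * (1\<^sup>2 + p\<^sup>2))"
        unfolding power_mult_distrib by (intro mult_left_mono add_square_le) auto
      finally show ?thesis by (simp add: algebra_simps)
    qed
    have "(?N w)\<^sup>2 * exp (- t\<^sup>2 / 4) \<le> C + C * ?S"
    proof (cases "1 < \<rho>")
      case True
      have "p \<le> \<rho> * p" using True nn by (simp add: mult_le_cancel_right1)
      then have "p\<^sup>2 \<le> (d * t)\<^sup>2" using \<rho>p nn by (intro power_mono) auto
      then have "2 * A\<^sup>2 * (1 + p\<^sup>2) \<le> 2 * A\<^sup>2 * (1 + (d * t)\<^sup>2)"
        by (intro mult_left_mono add_left_mono) auto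
      with N2 have "(?N w)\<^sup>2 * exp (- t\<^sup>2 / 4) \<le> 2 * A\<^sup>2 * (1 + d\<^sup>2 * t\<^sup>2) * exp (- t\<^sup>2 / 4)"
        by (intro mult_right_mono) (auto simp: power_mult_distrib)
      also have "\<dots> = 2 * A\<^sup>2 * (exp (- t\<^sup>2 / 4) + 4 * d\<^sup>2 * (t\<^sup>2 / 4 * exp (- t\<^sup>2 / 4)))"
        by (simp add: algebra_simps)
      also have "\<dots> \<le> 2 * A\<^sup>2 * (1 + 4 * d\<^sup>2 * 1)"
      proof (intro mult_left_mono add_mono)
        have "t\<^sup>2 / 4 \<le> exp (t\<^sup>2 / 4)" using exp_ge_add_one_self[of "t\<^sup>2 / 4"] by linarith
        then show "t\<^sup>2 / 4 * exp (- t\<^sup>2 / 4) \<le> 1" by (simp add: exp_minus divide_simps)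
      qed auto
      also have "\<dots> \<le> C" by (simp add: C_def)
      also have "\<dots> \<le> C + C * ?S" using C0 S0 by simp
      finally show ?thesis .
    next
      case False
      have pw: "(1 + \<rho>) ^ (degree P - 1) \<le> b"
        using False nn unfolding b_def by (intro power_mono) auto
      have "?N r \<le> (1 + \<rho>) ^ (degree P - 1) * ?N w"
        using slope_weight_mono_dist[of P r w] by (simp add: \<rho>_def norm_minus_commute)
      also have "\<dots> \<le> b * ?N w"
        using pw slope_weight_ge_1[of P w] by (intro mult_right_mono) auto
      finally have Nr: "(?N r)\<^sup>2 \<le> b\<^sup>2 * (?N w)\<^sup>2"
        using slope_weight_ge_1[of P r] by (simp add: power_mono flip: power_mult_distrib)
      have "?N w \<le> (1 + \<rho>) ^ (degree P - 1) * ?N r"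
        using slope_weight_mono_dist[of P w r] by (simp add: \<rho>_def)
      also have "\<dots> \<le> b * ?N r"
        using pw slope_weight_ge_1[of P r] by (intro mult_right_mono) auto
      finally have Nw: "(?N w)\<^sup>2 \<le> b\<^sup>2 * (?N r)\<^sup>2"
        using slope_weight_ge_1[of P w] by (simp add: power_mono flip: power_mult_distrib)
      have "(?N r)\<^sup>2 * \<rho>\<^sup>2 \<le> b\<^sup>2 * (2 * A\<^sup>2 * (1 + p\<^sup>2)) * \<rho>\<^sup>2"
        using order_trans[OF Nr mult_left_mono[OF N2, of "b\<^sup>2"]] by (intro mult_right_mono) auto
      also have "\<dots> = 2 * A\<^sup>2 * b\<^sup>2 * (\<rho>\<^sup>2 + (\<rho> * p)\<^sup>2)"
        by (simp add: algebra_simps power_mult_distrib)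
      also have "\<dots> \<le> 2 * A\<^sup>2 * b\<^sup>2 * (1 + (d * t)\<^sup>2)"
        using False nn \<rho>p by (intro mult_left_mono add_mono power_mono power_le_one) auto
      also have "\<dots> \<le> 2 * A\<^sup>2 * b\<^sup>2 * (d\<^sup>2 * 4 + (d * t)\<^sup>2)"
        using d by (intro mult_left_mono add_right_mono) (auto intro: order_trans[OF one_le_power[of d 2]])
      finally have "\<kappa> * ((?N r)\<^sup>2 * \<rho>\<^sup>2) \<le> \<kappa> * (2 * A\<^sup>2 * b\<^sup>2 * (d\<^sup>2 * 4 + (d * t)\<^sup>2))"
        using \<open>0 < \<kappa>\<close> by (intro mult_left_mono) auto
      also have "\<dots> = 1 + t\<^sup>2 / 4"
        using A(1) b d by (simp add: \<kappa>_def field_simps power_mult_distrib)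
      finally have "- t\<^sup>2 / 4 \<le> 1 + - \<kappa> * (?N r)\<^sup>2 * \<rho>\<^sup>2" by simp
      then have "exp (- t\<^sup>2 / 4) \<le> exp 1 * exp (- \<kappa> * (?N r)\<^sup>2 * \<rho>\<^sup>2)"
        by (metis exp_add exp_le_cancel_iff)
      with Nw have "(?N w)\<^sup>2 * exp (- t\<^sup>2 / 4) \<le> (b\<^sup>2 * (?N r)\<^sup>2) * (exp 1 * exp (- \<kappa> * (?N r)\<^sup>2 * \<rho>\<^sup>2))"
        by (intro mult_mono) auto
      also have "\<dots> = (exp 1 * b\<^sup>2) * ((?N r)\<^sup>2 * exp (- \<kappa> * (?N r)\<^sup>2 * \<rho>\<^sup>2))"
        by simp
      also have "\<dots> \<le> C * ?S"
      proof (intro mult_mono)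
        show "(?N r)\<^sup>2 * exp (- \<kappa> * (?N r)\<^sup>2 * \<rho>\<^sup>2) \<le> ?S"
          using finZ r(1) unfolding \<rho>_def
          by (intro member_le_sum[where f = "\<lambda>r. (?N r)\<^sup>2 * exp (- \<kappa> * (?N r)\<^sup>2 * (cmod (w - r))\<^sup>2)"]) auto
      qed (auto simp: C_def C0[unfolded C_def])
      also have "\<dots> \<le> C + C * ?S" using C0 by simp
      finally show ?thesis .
    qed
    then show "(?N w)\<^sup>2 * exp (- (cmod (poly P w - \<zeta>))\<^sup>2 / 4) \<le>
        C + C * (\<Sum>r | poly P r = \<zeta>. (?N r)\<^sup>2 * exp (- \<kappa> * (?N r)\<^sup>2 * (cmod (w - r))\<^sup>2))"
      unfolding Z_def t_def .
  qed
qed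

lemma slope_weight_measurable [measurable]: "slope_weight P \<in> borel_measurable borel"
  unfolding slope_weight_def by measurable

lemma poly_measurable [measurable]: "poly p \<in> borel_measurable borel" for p :: "complex poly"
  by (intro borel_measurable_continuous_onI continuous_intros)

text \<open>Each of the at most \<open>degree P\<close> Gaussians in the previous bound has, after rescaling, the same
  integral, whatever the weight at its centre is.\<close>

lemma graph_gaussian_area_bounded:
  fixes P :: "complex poly"
  obtains C where "C < \<infinity>"
    "\<And>z \<zeta>. (\<integral>\<^sup>+ w. ennreal ((slope_weight P w)\<^sup>2 *
       exp (- ((cmod (w - z))\<^sup>2 + (cmod (poly P w - \<zeta>))\<^sup>2) / 4)) \<partial>lborel) \<le> C"
proof (cases "degree P")
  case 0
  show ?thesis
  proof (rule that)
    show "(\<integral>\<^sup>+ w. ennreal (exp (- (1/4) * (cmod w)\<^sup>2)) \<partial>lborel) < \<infinity>"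
      by (rule gaussian_nn_integral_finite) simp
    show "(\<integral>\<^sup>+ w. ennreal ((slope_weight P w)\<^sup>2 *
        exp (- ((cmod (w - z))\<^sup>2 + (cmod (poly P w - \<zeta>))\<^sup>2) / 4)) \<partial>lborel) \<le>
        (\<integral>\<^sup>+ w. ennreal (exp (- (1/4) * (cmod w)\<^sup>2)) \<partial>lborel)" for z \<zeta>
      unfolding nn_integral_gaussian_translate[where a = z, symmetric]
      using 0 by (intro nn_integral_mono ennreal_leI) (simp add: slope_weight_def)
  qed
next
  case (Suc n)
  then have deg: "degree P > 0" by simp
  let ?N = "slope_weight P"
  let ?G = "\<lambda>c. (\<integral>\<^sup>+ w. ennreal (exp (- c * (cmod w)\<^sup>2)) \<partial>lborel)"
  obtain C \<kappa> where C: "0 \<le> C" "0 < \<kappa>" 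
    "\<And>w \<zeta>. (?N w)\<^sup>2 * exp (- (cmod (poly P w - \<zeta>))\<^sup>2 / 4) \<le>
      C + C * (\<Sum>r | poly P r = \<zeta>. (?N r)\<^sup>2 * exp (- \<kappa> * (?N r)\<^sup>2 * (cmod (w - r))\<^sup>2))"
    using slope_weight_gaussian_bound[OF deg] by blast
  show ?thesis
  proof (rule that)
    show "ennreal C * ?G (1/4) + ennreal C * (ennreal (real (degree P)) * ?G \<kappa>) < \<infinity>"
      using gaussian_nn_integral_finite[of "1/4", where 'a = complex]
        gaussian_nn_integral_finite[OF C(2), where 'a = complex]
      by (simp add: ennreal_mult_less_top)
    fix z \<zeta>
    let ?Z = "{r. poly P r = \<zeta>}"
    have eqZ: "?Z = {r. poly (P - [:\<zeta>:]) r = 0}" by auto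
    have degQ: "degree (P - [:\<zeta>:]) = degree P" using deg by (rule degree_diff_pCons_0)
    then have Q0: "P - [:\<zeta>:] \<noteq> 0" using deg by auto
    have Z: "finite ?Z" "card ?Z \<le> degree P"
      unfolding eqZ using poly_roots_finite[OF Q0] card_poly_roots_bound[OF Q0] degQ by auto
    let ?g = "\<lambda>r w. (?N r)\<^sup>2 * exp (- \<kappa> * (?N r)\<^sup>2 * (cmod (w - r))\<^sup>2)"
    have "(\<integral>\<^sup>+ w. ennreal ((?N w)\<^sup>2 * exp (- ((cmod (w - z))\<^sup>2 + (cmod (poly P w - \<zeta>))\<^sup>2) / 4)) \<partial>lborel)
        \<le> (\<integral>\<^sup>+ w. ennreal C * ennreal (exp (- (1/4) * (cmod (w - z))\<^sup>2)) +
              ennreal C * (\<Sum>r\<in>?Z. ennreal (?g r w)) \<partial>lborel)"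
    proof (intro nn_integral_mono)
      fix w
      let ?e = "exp (- (1/4) * (cmod (w - z))\<^sup>2)"
      have "(?N w)\<^sup>2 * exp (- ((cmod (w - z))\<^sup>2 + (cmod (poly P w - \<zeta>))\<^sup>2) / 4) =
          ((?N w)\<^sup>2 * exp (- (cmod (poly P w - \<zeta>))\<^sup>2 / 4)) * ?e"
        by (simp add: exp_add[symmetric] add_divide_distrib)
      also have "\<dots> \<le> (C + C * (\<Sum>r\<in>?Z. ?g r w)) * ?e"
        by (intro mult_right_mono C(3)) auto
      also have "\<dots> = C * ?e + C * (\<Sum>r\<in>?Z. ?g r w) * ?e"
        by (simp add: distrib_right)
      also have "\<dots> \<le> C * ?e + C * (\<Sum>r\<in>?Z. ?g r w) * 1"
        using C(1) by (intro add_left_mono mult_left_mono mult_nonneg_nonneg sum_nonneg) auto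
      finally have "ennreal ((?N w)\<^sup>2 * exp (- ((cmod (w - z))\<^sup>2 + (cmod (poly P w - \<zeta>))\<^sup>2) / 4))
          \<le> ennreal (C * ?e + C * (\<Sum>r\<in>?Z. ?g r w))"
        by (intro ennreal_leI) simp
      also have "\<dots> = ennreal C * ennreal ?e + ennreal C * (\<Sum>r\<in>?Z. ennreal (?g r w))"
        using C(1) by (subst sum_ennreal) (auto simp: ennreal_plus ennreal_mult sum_nonneg)
      finally show "ennreal ((?N w)\<^sup>2 * exp (- ((cmod (w - z))\<^sup>2 + (cmod (poly P w - \<zeta>))\<^sup>2) / 4))
          \<le> ennreal C * ennreal ?e + ennreal C * (\<Sum>r\<in>?Z. ennreal (?g r w))" .
    qed
    also have "\<dots> = ennreal C * (\<integral>\<^sup>+ w. ennreal (exp (- (1/4) * (cmod (w - z))\<^sup>2)) \<partial>lborel) +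
        ennreal C * (\<Sum>r\<in>?Z. \<integral>\<^sup>+ w. ennreal (?g r w) \<partial>lborel)"
      by (simp add: nn_integral_add nn_integral_cmult nn_integral_sum del: sum_ennreal)
    also have "\<dots> = ennreal C * ?G (1/4) + ennreal C * (\<Sum>r\<in>?Z. ?G \<kappa>)"
    proof -
      have "(\<integral>\<^sup>+ w. ennreal (?g r w) \<partial>lborel) = ?G \<kappa>" for r
        using slope_weight_ge_1[of P r] by (intro nn_integral_gaussian_rescale) auto
      then show ?thesis by (simp only: nn_integral_gaussian_translate)
    qed
    also have "\<dots> \<le> ennreal C * ?G (1/4) + ennreal C * (ennreal (real (degree P)) * ?G \<kappa>)"
      using Z(2) by (intro add_left_mono mult_left_mono) (auto simp: ennreal_of_nat_eq_real_of_nat[symmetric] intro!: mult_right_mono)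
    finally show "(\<integral>\<^sup>+ w. ennreal ((?N w)\<^sup>2 *
        exp (- ((cmod (w - z))\<^sup>2 + (cmod (poly P w - \<zeta>))\<^sup>2) / 4)) \<partial>lborel) \<le> \<dots>" .
  qed
qed

section \<open>Holomorphic functions of several variables\<close>

lemma holomorphic_in_const: "(\<lambda>v. c) holomorphic_in U"
  unfolding holomorphic_in_def by (auto intro!: exI[of _ "\<lambda>h. 0"])

lemma holomorphic_in_component: "(\<lambda>v. v $ i) holomorphic_in U"
  unfolding holomorphic_in_def
  by (auto intro!: exI[of _ "\<lambda>h. h $ i"] bounded_linear_imp_has_derivative bounded_linear_vec_nth)

lemma holomorphic_in_add:
  assumes "f holomorphic_in U" "g holomorphic_in U"
  shows "(\<lambda>v. f v + g v) holomorphic_in U"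
  unfolding holomorphic_in_def
proof
  fix z assume "z \<in> U"
  with assms obtain D E where "(f has_derivative D) (at z)" "\<forall>c v. D (c *s v) = c * D v"
    "(g has_derivative E) (at z)" "\<forall>c v. E (c *s v) = c * E v"
    unfolding holomorphic_in_def by blast
  then show "\<exists>D. ((\<lambda>v. f v + g v) has_derivative D) (at z) \<and> (\<forall>c v. D (c *s v) = c * D v)"
    by (intro exI[of _ "\<lambda>h. D h + E h"]) (auto intro!: derivative_intros simp: algebra_simps)
qed

lemma holomorphic_in_mult:
  assumes "f holomorphic_in U" "g holomorphic_in U"
  shows "(\<lambda>v. f v * g v) holomorphic_in U"
  unfolding holomorphic_in_def
proof
  fix z assume "z \<in> U"
  with assms obtain D E where "(f has_derivative D) (at z)" "\<forall>c v. D (c *s v) = c * D v"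
    "(g has_derivative E) (at z)" "\<forall>c v. E (c *s v) = c * E v"
    unfolding holomorphic_in_def by blast
  then show "\<exists>D. ((\<lambda>v. f v * g v) has_derivative D) (at z) \<and> (\<forall>c v. D (c *s v) = c * D v)"
    by (intro exI[of _ "\<lambda>h. f z * E h + D h * g z"] conjI has_derivative_mult) (simp_all add: algebra_simps)
qed

lemma holomorphic_in_power: "f holomorphic_in U \<Longrightarrow> (\<lambda>v. f v ^ n) holomorphic_in U"
  by (induction n) (auto intro: holomorphic_in_const holomorphic_in_mult)

lemma holomorphic_in_sum:
  "(\<And>i. i \<in> I \<Longrightarrow> f i holomorphic_in U) \<Longrightarrow> (\<lambda>v. \<Sum>i\<in>I. f i v) holomorphic_in U"
  by (induction I rule: infinite_finite_induct) (auto intro: holomorphic_in_const holomorphic_in_add)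

lemma holomorphic_in_poly: "f holomorphic_in U \<Longrightarrow> (\<lambda>v. poly p (f v)) holomorphic_in U"
  unfolding poly_altdef
  by (intro holomorphic_in_sum holomorphic_in_mult holomorphic_in_const holomorphic_in_power)

lemma holomorphic_in_imp_continuous_on: "f holomorphic_in U \<Longrightarrow> continuous_on U f"
  unfolding holomorphic_in_def
  by (meson continuous_at_imp_continuous_on has_derivative_continuous)

text \<open>Differentiation under the integral sign: the remainder in the first order Taylor formula of the
  exponential is quadratic in the increment, with a coefficient that a slightly larger exponential
  weight absorbs.\<close>

lemma holomorphic_in_exp_integral:
  fixes c \<alpha> \<beta> :: "'b \<Rightarrow> complex"
  assumes [measurable]: "c \<in> borel_measurable M" "\<alpha> \<in> borel_measurable M" "\<beta> \<in> borel_measurable M"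
    and int: "\<And>R. integrable M (\<lambda>x. cmod (c x) * exp (R * (cmod (\<alpha> x) + cmod (\<beta> x))))"
  shows "(\<lambda>v::complex ^ 2. \<integral>x. c x * exp (v $ 1 * \<alpha> x + v $ 2 * \<beta> x) \<partial>M) holomorphic_in UNIV"
  unfolding holomorphic_in_def
proof
  fix v :: "complex ^ 2"
  define s where "s x = cmod (\<alpha> x) + cmod (\<beta> x)" for x
  have [measurable]: "s \<in> borel_measurable M" unfolding s_def by measurable
  have s0: "0 \<le> s x" for x by (simp add: s_def)
  have lin: "cmod (u $ 1 * \<alpha> x + u $ 2 * \<beta> x) \<le> norm u * s x" for u :: "complex ^ 2" and x
  proof -
    have "cmod (u $ 1 * \<alpha> x + u $ 2 * \<beta> x) \<le> cmod (u $ 1) * cmod (\<alpha> x) + cmod (u $ 2) * cmod (\<beta> x)"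
      by (metis norm_mult norm_triangle_ineq)
    also have "\<dots> \<le> norm u * cmod (\<alpha> x) + norm u * cmod (\<beta> x)"
      by (intro add_mono mult_right_mono Finite_Cartesian_Product.norm_nth_le) auto
    finally show ?thesis by (simp add: s_def distrib_left)
  qed
  have nexp: "cmod (exp (u $ 1 * \<alpha> x + u $ 2 * \<beta> x)) \<le> exp (norm u * s x)" for u :: "complex ^ 2" and x
    using order_trans[OF complex_Re_le_cmod lin, of u x] by simp
  have s1: "s x \<le> exp (s x)" for x using exp_ge_add_one_self[of "s x"] by linarith
  have dom: "integrable M (\<lambda>x. c x * k x)" if [measurable]: "k \<in> borel_measurable M"
    and "\<And>x. cmod (k x) \<le> exp (R * s x)" for k :: "'b \<Rightarrow> complex" and R
    by (rule Bochner_Integration.integrable_bound[OF int[of R]])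
      (use that(2) in \<open>auto simp: norm_mult s_def[symmetric] mult_left_mono\<close>)
  let ?e = "\<lambda>u x. exp (u $ 1 * \<alpha> x + u $ 2 * \<beta> x)"
  have i0: "integrable M (\<lambda>x. c x * ?e u x)" for u :: "complex ^ 2"
    by (rule dom[OF _ nexp]) measurable
  have ik: "integrable M (\<lambda>x. c x * (\<gamma> x * ?e v x))"
    if [measurable]: "\<gamma> \<in> borel_measurable M" and "\<And>x. cmod (\<gamma> x) \<le> s x" for \<gamma>
  proof (rule dom)
    show "cmod (\<gamma> x * ?e v x) \<le> exp ((norm v + 1) * s x)" for x
      using mult_mono[OF order_trans[OF that(2) s1] nexp[of v x]] 
      by (simp add: norm_mult exp_add[symmetric] algebra_simps)
  qed measurable
  have ia: "integrable M (\<lambda>x. c x * (\<alpha> x * ?e v x))" and ib: "integrable M (\<lambda>x. c x * (\<beta> x * ?e v x))"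
    by (rule ik; simp add: s_def)+
  define D where "D h = h $ 1 * (\<integral>x. c x * (\<alpha> x * ?e v x) \<partial>M) + h $ 2 * (\<integral>x. c x * (\<beta> x * ?e v x) \<partial>M)"
    for h :: "complex ^ 2"
  define K where "K = (\<integral>x. 2 * (cmod (c x) * exp ((norm v + 2) * s x)) \<partial>M)"
  have iK: "integrable M (\<lambda>x. 2 * (cmod (c x) * exp ((norm v + 2) * s x)))"
    using int[of "norm v + 2"] by (simp add: s_def)
  have "((\<lambda>v. \<integral>x. c x * ?e v x \<partial>M) has_derivative D) (at v)"
  proof (rule has_derivativeI_sandwich[where e = 1 and H = "\<lambda>u. K * norm (u - v)"])
    show "bounded_linear D"
      unfolding D_def by (intro bounded_linear_add bounded_linear_mult_left[THEN bounded_linear_compose] bounded_linear_vec_nth)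
    show "((\<lambda>u. K * norm (u - v)) \<longlongrightarrow> 0) (at v)"
      by (auto intro!: tendsto_eq_intros)
    fix u assume u: "u \<noteq> v" "dist u v < 1"
    define h where "h = u - v"
    have h: "0 < norm h" "norm h \<le> 1" using u by (auto simp: h_def dist_norm)
    let ?a = "\<lambda>x. h $ 1 * \<alpha> x + h $ 2 * \<beta> x"
    have eu: "?e u x = ?e v x * exp (?a x)" for x
      by (simp add: exp_add[symmetric] h_def algebra_simps)
    have "(\<integral>x. c x * ?e u x \<partial>M) - (\<integral>x. c x * ?e v x \<partial>M) - D h =
        (\<integral>x. c x * ?e u x - c x * ?e v x - (h $ 1 * (c x * (\<alpha> x * ?e v x)) + h $ 2 * (c x * (\<beta> x * ?e v x))) \<partial>M)"
      unfolding D_def using i0 ia ib by simp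
    also have "\<dots> = (\<integral>x. c x * ?e v x * (exp (?a x) - 1 - ?a x) \<partial>M)"
      by (intro Bochner_Integration.integral_cong refl) (simp only: eu, simp add: algebra_simps)
    finally have eq: "(\<integral>x. c x * ?e u x \<partial>M) - (\<integral>x. c x * ?e v x \<partial>M) - D h = \<dots>" .
    have "norm (\<integral>x. c x * ?e v x * (exp (?a x) - 1 - ?a x) \<partial>M) \<le>
        (\<integral>x. (norm h)\<^sup>2 * (2 * (cmod (c x) * exp ((norm v + 2) * s x))) \<partial>M)"
    proof (rule order_trans[OF integral_norm_bound integral_mono])
      have "integrable M (\<lambda>x. c x * ?e u x - c x * ?e v x - (h $ 1 * (c x * (\<alpha> x * ?e v x)) + h $ 2 * (c x * (\<beta> x * ?e v x))))"
        using i0 ia ib by simp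
      also have "(\<lambda>x. c x * ?e u x - c x * ?e v x - (h $ 1 * (c x * (\<alpha> x * ?e v x)) + h $ 2 * (c x * (\<beta> x * ?e v x)))) = (\<lambda>x. c x * ?e v x * (exp (?a x) - 1 - ?a x))"
        by (simp only: eu) (simp add: algebra_simps)
      finally show "integrable M (\<lambda>x. norm (c x * ?e v x * (exp (?a x) - 1 - ?a x)))"
        by (rule integrable_norm)
      show "integrable M (\<lambda>x. (norm h)\<^sup>2 * (2 * (cmod (c x) * exp ((norm v + 2) * s x))))"
        using iK by (rule integrable_mult_right)
      fix x
      have "cmod (exp (?a x) - (\<Sum>k\<le>1. ?a x ^ k / fact k)) \<le> exp \<bar>Re (?a x)\<bar> * cmod (?a x) ^ Suc 1 / fact 1"
        by (rule Taylor_exp)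
      then have "cmod (exp (?a x) - 1 - ?a x) \<le> exp \<bar>Re (?a x)\<bar> * (cmod (?a x))\<^sup>2"
        by (simp add: diff_diff_eq power2_eq_square)
      also have "\<dots> \<le> exp (s x) * (norm h * s x)\<^sup>2"
      proof (intro mult_mono power_mono lin)
        have "\<bar>Re (?a x)\<bar> \<le> norm h * s x" using abs_Re_le_cmod lin order_trans by blast
        also have "\<dots> \<le> s x" using h s0[of x] by (simp add: mult_left_le_one_le)
        finally show "exp \<bar>Re (?a x)\<bar> \<le> exp (s x)" by simp
      qed auto
      also have "\<dots> \<le> (norm h)\<^sup>2 * (2 * exp (2 * s x))"
      proof -
        have "(s x)\<^sup>2 \<le> 2 * exp (s x)"
          using exp_lower_Taylor_quadratic[OF s0[of x]] s0[of x] by (simp add: power2_eq_square)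
        then have "exp (s x) * ((norm h)\<^sup>2 * (s x)\<^sup>2) \<le> exp (s x) * ((norm h)\<^sup>2 * (2 * exp (s x)))"
          by (intro mult_left_mono) auto
        moreover have "exp (2 * s x) = exp (s x) * exp (s x)"
          by (simp flip: exp_add)
        ultimately show ?thesis by (simp add: power_mult_distrib mult_ac)
      qed
      finally have "cmod (c x) * (cmod (?e v x) * cmod (exp (?a x) - 1 - ?a x)) \<le>
          cmod (c x) * (exp (norm v * s x) * ((norm h)\<^sup>2 * (2 * exp (2 * s x))))"
        by (intro mult_left_mono mult_mono nexp) auto
      also have "\<dots> = (norm h)\<^sup>2 * (2 * (cmod (c x) * exp ((norm v + 2) * s x)))"
        by (simp add: distrib_right exp_add)
      finally show "norm (c x * ?e v x * (exp (?a x) - 1 - ?a x)) \<le> (norm h)\<^sup>2 * (2 * (cmod (c x) * exp ((norm v + 2) * s x)))"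
        by (simp only: norm_mult mult.assoc)
    qed
    also have "\<dots> = K * norm h * norm h"
      unfolding K_def by (simp add: power2_eq_square)
    finally show "norm ((\<integral>x. c x * ?e u x \<partial>M) - (\<integral>x. c x * ?e v x \<partial>M) - D (u - v)) / norm (u - v) \<le> K * norm (u - v)"
      using h(1) unfolding h_def[symmetric] eq by (simp add: divide_le_eq)
  qed simp
  moreover have "D (a *s h) = a * D h" for a h
    by (simp add: D_def algebra_simps)
  ultimately show "\<exists>D. ((\<lambda>v. \<integral>x. c x * ?e v x \<partial>M) has_derivative D) (at v) \<and> (\<forall>c v. D (c *s v) = c * D v)"
    by blast
qed

section \<open>The interpolation kernel\<close>

lemma power_div_fact_le_exp:
  fixes x :: real
  assumes "0 \<le> x"
  shows "x ^ n / fact n \<le> exp x"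
proof -
  have "(\<Sum>k\<in>{n}. x ^ k /\<^sub>R fact k) \<le> (\<Sum>k. x ^ k /\<^sub>R fact k)"
    using assms by (intro sum_le_suminf summable_exp_generic) auto
  then show ?thesis by (simp add: exp_def divide_inverse mult.commute)
qed

lemma power_le_exp_quadratic:
  fixes x :: real
  assumes "0 \<le> x" "0 < a"
  shows "(1 + x) ^ n \<le> fact n * exp (1 + 1 / (4 * a)) * exp (a * x\<^sup>2)"
proof -
  have "x \<le> 1 / (4 * a) + a * x\<^sup>2"
  proof -
    have "0 \<le> a * (x - 1 / (2 * a))\<^sup>2" using assms by simp
    also have "a * (x - 1 / (2 * a))\<^sup>2 = a * x\<^sup>2 - x + 1 / (4 * a)"
      using assms by (simp add: power2_eq_square field_simps)
    finally show ?thesis by simp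
  qed
  then have "exp (1 + x) \<le> exp (1 + 1 / (4 * a)) * exp (a * x\<^sup>2)"
    by (simp flip: exp_add)
  then have "fact n * exp (1 + x) \<le> fact n * (exp (1 + 1 / (4 * a)) * exp (a * x\<^sup>2))"
    by (intro mult_left_mono) auto
  moreover have "(1 + x) ^ n \<le> fact n * exp (1 + x)"
    using power_div_fact_le_exp[of "1 + x" n] assms by (simp add: divide_le_eq mult.commute)
  ultimately show ?thesis
    unfolding mult.assoc by (rule order_trans[rotated])
qed

lemma mult_le_sum_squares:
  fixes a b :: real
  assumes "0 \<le> a" "0 \<le> b"
  shows "a * b \<le> a\<^sup>2 + b\<^sup>2"
proof -
  have "0 \<le> (a - b)\<^sup>2" "0 \<le> a * b"
    using assms by auto
  then show ?thesis
    unfolding power2_diff by linarith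
qed

definition graph_weight :: "complex poly \<Rightarrow> complex \<Rightarrow> real" where
  "graph_weight P w = (cmod w)\<^sup>2 + (cmod (poly P w))\<^sup>2"

lemma graph_weight_measurable [measurable]: "graph_weight P \<in> borel_measurable borel"
  unfolding graph_weight_def by measurable

lemma integrable_gaussian: "0 < c \<Longrightarrow> integrable lborel (\<lambda>x::'a::euclidean_space. exp (- c * (norm x)\<^sup>2))"
  using gaussian_nn_integral_finite[of c, where 'a = 'a] by (simp add: integrable_iff_bounded)

text \<open>Half of the Gaussian weight pays for the square integrable function, the other half for the
  polynomial and exponential factors.\<close>

lemma integrable_against_graph_weight:
  fixes g :: "complex \<Rightarrow> complex"
  assumes [measurable]: "g \<in> borel_measurable borel"
    and g: "(\<integral>\<^sup>+ w. ennreal ((cmod (g w))\<^sup>2 * exp (- graph_weight P w)) \<partial>lborel) < \<infinity>"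
  shows "integrable lborel (\<lambda>w. cmod (g w) * (1 + cmod w) ^ k *
      exp (R * (cmod w + cmod (poly P w)) - graph_weight P w))"
proof -
  define C where "C = fact (2 * k) * exp (1 + 1 / (4 * (1/4))) * exp (5 * R\<^sup>2)"
  have "integrable lborel (\<lambda>w. (cmod (g w))\<^sup>2 * exp (- graph_weight P w) + C * exp (- (1/2) * (norm w)\<^sup>2))"
    using g by (intro Bochner_Integration.integrable_add integrable_mult_right integrable_gaussian)
      (auto simp: integrable_iff_bounded)
  then show ?thesis
  proof (rule Bochner_Integration.integrable_bound)
    show "AE w in lborel. norm (cmod (g w) * (1 + cmod w) ^ k * exp (R * (cmod w + cmod (poly P w)) - graph_weight P w))
        \<le> norm ((cmod (g w))\<^sup>2 * exp (- graph_weight P w) + C * exp (- (1/2) * (norm w)\<^sup>2))"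
    proof (rule AE_I2)
      fix w
      let ?x = "cmod w" and ?p = "cmod (poly P w)"
      let ?a = "cmod (g w) * exp (- graph_weight P w / 2)"
      let ?b = "(1 + ?x) ^ k * exp (R * (?x + ?p) - graph_weight P w / 2)"
      have split: "R * (?x + ?p) - graph_weight P w = - graph_weight P w / 2 + (R * (?x + ?p) - graph_weight P w / 2)"
        by simp
      have "cmod (g w) * (1 + ?x) ^ k * exp (R * (?x + ?p) - graph_weight P w) = ?a * ?b"
        unfolding split exp_add by (simp only: mult_ac)
      also have "\<dots> \<le> ?a\<^sup>2 + ?b\<^sup>2"
        by (rule mult_le_sum_squares) auto
      also have "?a\<^sup>2 = (cmod (g w))\<^sup>2 * exp (- graph_weight P w)"
        unfolding power_mult_distrib exp_double[symmetric] by simp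
      also have "?b\<^sup>2 \<le> C * exp (- (1/2) * ?x\<^sup>2)"
      proof -
        have "?b\<^sup>2 = (1 + ?x) ^ (2 * k) * exp (2 * (R * (?x + ?p) - graph_weight P w / 2))"
          unfolding power_mult_distrib exp_double power_even_eq ..
        also have "\<dots> = (1 + ?x) ^ (2 * k) * exp (2 * (R * (?x + ?p)) - graph_weight P w)"
          by simp
        also have "\<dots> \<le> (fact (2 * k) * exp (1 + 1 / (4 * (1/4))) * exp (1/4 * ?x\<^sup>2)) * exp (5 * R\<^sup>2 - 3/4 * ?x\<^sup>2)"
        proof (intro mult_mono power_le_exp_quadratic)
          have "0 \<le> (2 * R - ?x / 2)\<^sup>2" "0 \<le> (R - ?p)\<^sup>2" by auto
          then show "exp (2 * (R * (?x + ?p)) - graph_weight P w) \<le> exp (5 * R\<^sup>2 - 3/4 * ?x\<^sup>2)"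
            unfolding graph_weight_def exp_le_cancel_iff power2_diff by (simp add: power_mult_distrib power_divide distrib_left)
        qed auto
        also have "\<dots> = C * (exp (1/4 * ?x\<^sup>2) * exp (- (3/4 * ?x\<^sup>2)))"
          unfolding C_def diff_conv_add_uminus exp_add by (simp only: mult_ac mult_minus_left)
        also have "exp (1/4 * ?x\<^sup>2) * exp (- (3/4 * ?x\<^sup>2)) = exp (- (1/2) * ?x\<^sup>2)"
          unfolding exp_add[symmetric] by simp
        finally show ?thesis .
      qed
      finally have le: "cmod (g w) * (1 + ?x) ^ k * exp (R * (?x + ?p) - graph_weight P w) \<le>
          (cmod (g w))\<^sup>2 * exp (- graph_weight P w) + C * exp (- (1/2) * ?x\<^sup>2)"
        by simp
      show "norm (cmod (g w) * (1 + ?x) ^ k * exp (R * (?x + ?p) - graph_weight P w))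
        \<le> norm ((cmod (g w))\<^sup>2 * exp (- graph_weight P w) + C * exp (- (1/2) * ?x\<^sup>2))"
        unfolding real_norm_def by (intro order_trans[OF _ order_trans[OF le abs_ge_self]]) simp
    qed
  qed measurable
qed

lemma integrable_exp_graph_weight:
  "integrable lborel (\<lambda>w. (1 + cmod w) ^ k * exp (R * (cmod w + cmod (poly P w)) - graph_weight P w))"
proof -
  have "(\<integral>\<^sup>+ w. ennreal ((cmod 1)\<^sup>2 * exp (- graph_weight P w)) \<partial>lborel) \<le>
      (\<integral>\<^sup>+ w. ennreal (exp (- 1 * (cmod w)\<^sup>2)) \<partial>lborel)"
    by (intro nn_integral_mono ennreal_leI) (simp add: graph_weight_def)
  also have "\<dots> < \<infinity>" by (rule gaussian_nn_integral_finite) simp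
  finally have "integrable lborel (\<lambda>w. cmod 1 * (1 + cmod w) ^ k *
      exp (R * (cmod w + cmod (poly P w)) - graph_weight P w))"
    by (intro integrable_against_graph_weight) auto
  then show ?thesis by simp
qed

text \<open>The polynomial \<open>(P z - P w) / (z - w)\<close>, ordered by powers of \<open>z\<close>.\<close>

definition diff_quot :: "complex poly \<Rightarrow> complex \<Rightarrow> complex \<Rightarrow> complex" where
  "diff_quot P z w = (\<Sum>i<degree P. (\<Sum>k=Suc i..degree P. coeff P k * w ^ (k - i - 1)) * z ^ i)"

lemma diff_quot_mult: "(w - z) * diff_quot P z w = poly P w - poly P z"
proof (cases "degree P = 0")
  case True
  then show ?thesis by (simp add: diff_quot_def poly_altdef)
next
  case False
  then have "poly P z - poly P w = (z - w) * diff_quot P z w"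
    unfolding diff_quot_def poly_altdef by (intro polyfun_diff) simp
  then show ?thesis by (simp add: algebra_simps)
qed

lemma diff_quot_holomorphic: "diff_quot P z holomorphic_on UNIV"
  unfolding diff_quot_def by (intro holomorphic_intros)

lemma diff_quot_bound:
  obtains K where "0 \<le> K"
    "\<And>z w. cmod (diff_quot P z w) \<le> K * slope_weight P w * (1 + cmod (w - z)) ^ (degree P - 1)"
proof (rule that[of "\<Sum>i<degree P. \<Sum>k=Suc i..degree P. cmod (coeff P k)"])
  fix z w
  let ?t = "1 + cmod (w - z)" and ?x = "1 + cmod w"
  have z: "cmod z \<le> ?x * ?t"
  proof -
    have "cmod z \<le> cmod w + cmod (w - z)"
      using norm_triangle_ineq4[of w "w - z"] by simp
    also have "\<dots> \<le> cmod w + cmod (w - z) + (1 + cmod w * cmod (w - z))" by simp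
    also have "\<dots> = ?x * ?t" by (simp add: algebra_simps)
    finally show ?thesis .
  qed
  have "cmod (diff_quot P z w) \<le> (\<Sum>i<degree P. \<Sum>k=Suc i..degree P. cmod (coeff P k) * cmod w ^ (k - i - 1) * cmod z ^ i)"
    unfolding diff_quot_def sum_distrib_right
    by (intro order_trans[OF norm_sum] sum_mono) (simp add: norm_mult norm_power)
  also have "\<dots> \<le> (\<Sum>i<degree P. \<Sum>k=Suc i..degree P. cmod (coeff P k) * (?x ^ (degree P - 1) * ?t ^ (degree P - 1)))"
  proof (intro sum_mono)
    fix i k assume ik: "i \<in> {..<degree P}" "k \<in> {Suc i..degree P}"
    have "cmod w ^ (k - i - 1) * cmod z ^ i \<le> ?x ^ (k - i - 1) * (?x * ?t) ^ i"
      using z by (intro mult_mono power_mono) auto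
    also have "\<dots> = ?x ^ (k - 1) * ?t ^ i"
      using ik by (simp add: power_mult_distrib flip: power_add mult.assoc)
    also have "\<dots> \<le> ?x ^ (degree P - 1) * ?t ^ (degree P - 1)"
      using ik by (intro mult_mono power_increasing) auto
    finally show "cmod (coeff P k) * cmod w ^ (k - i - 1) * cmod z ^ i \<le>
        cmod (coeff P k) * (?x ^ (degree P - 1) * ?t ^ (degree P - 1))"
      unfolding mult.assoc by (intro mult_left_mono) auto
  qed
  finally show "cmod (diff_quot P z w) \<le> (\<Sum>i<degree P. \<Sum>k=Suc i..degree P. cmod (coeff P k)) *
      slope_weight P w * ?t ^ (degree P - 1)"
    by (simp add: slope_weight_def sum_distrib_right mult.assoc)
qed (auto intro!: sum_nonneg)

text \<open>If \<open>S w = |w - z|\<^sup>2 + |P w - P z|\<^sup>2\<close>, then the derivative of \<open>S\<close> with respect to \<open>cnj w\<close> is \<open>w - z\<close>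
  times this factor. On the diagonal \<open>w = z\<close> it is the area element of the graph.\<close>

definition kernel_factor :: "complex poly \<Rightarrow> complex \<Rightarrow> complex \<Rightarrow> complex" where
  "kernel_factor P z w = 1 + diff_quot P z w * cnj (poly (pderiv P) w)"

lemma kernel_factor_bound:
  obtains L where "0 < L"
    "\<And>z w. cmod (kernel_factor P z w) \<le> L * (slope_weight P w)\<^sup>2 * (1 + cmod (w - z)) ^ (degree P - 1)"
proof -
  obtain K where K: "0 \<le> K"
    "\<And>z w. cmod (diff_quot P z w) \<le> K * slope_weight P w * (1 + cmod (w - z)) ^ (degree P - 1)"
    using diff_quot_bound by blast
  obtain A where A: "0 < A" "\<And>w. cmod (poly (pderiv P) w) \<le> A * slope_weight P w"
    using slope_weight_upper by blast
  show ?thesis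
  proof (rule that[of "1 + K * A"])
    show "0 < 1 + K * A" using K(1) A(1) by (simp add: add_pos_nonneg)
    fix z w
    let ?t = "(1 + cmod (w - z)) ^ (degree P - 1)" and ?N = "slope_weight P w"
    have "1 \<le> ?N\<^sup>2 * ?t"
    proof -
      have "1 * 1 \<le> ?N\<^sup>2 * ?t"
        using slope_weight_ge_1[of P w] by (intro mult_mono one_le_power) auto
      then show ?thesis by simp
    qed
    moreover have "cmod (diff_quot P z w) * cmod (poly (pderiv P) w) \<le> (K * ?N * ?t) * (A * ?N)"
      using K slope_weight_ge_1[of P w] by (intro mult_mono A K) auto
    moreover have "cmod (kernel_factor P z w) \<le> 1 + cmod (diff_quot P z w) * cmod (poly (pderiv P) w)"
      unfolding kernel_factor_def by (metis complex_mod_cnj norm_mult norm_one norm_triangle_ineq)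
    ultimately have "cmod (kernel_factor P z w) \<le> ?N\<^sup>2 * ?t + (K * ?N * ?t) * (A * ?N)"
      by linarith
    also have "\<dots> = (1 + K * A) * ?N\<^sup>2 * ?t"
      by (simp add: algebra_simps power2_eq_square)
    finally show "cmod (kernel_factor P z w) \<le> (1 + K * A) * ?N\<^sup>2 * ?t" .
  qed
qed

lemma one_plus_norm_diff_le: "1 + norm (w - z) \<le> (1 + norm z) * (1 + norm w)"
  for w z :: "'a::real_normed_vector"
  using norm_triangle_ineq4[of w z] mult_nonneg_nonneg[OF norm_ge_zero[of z] norm_ge_zero[of w]]
  by (simp only: distrib_left distrib_right mult_1_left mult_1_right)

section \<open>The reproducing identity\<close>

lemma entire_difference_quotient:
  assumes "f holomorphic_on UNIV"
  obtains k where "k holomorphic_on UNIV" "\<And>w. (w - z) * k w = f w - f z"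
  by (rule that[OF pole_lemma_open[OF assms open_UNIV, of z]]) auto

lemma entire_has_field_derivative: "f holomorphic_on UNIV \<Longrightarrow> (f has_field_derivative deriv f w) (at w)"
  using holomorphic_derivI by blast

lemma continuous_on_deriv_entire: "f holomorphic_on UNIV \<Longrightarrow> continuous_on A (deriv f)"
  by (meson continuous_on_subset holomorphic_deriv holomorphic_on_imp_continuous_on open_UNIV subset_UNIV)

lemma Re_pairing_le:
  "Re (a * cnj b + c * cnj d) \<le> (cmod a + cmod c) * (cmod b + cmod d)"
proof -
  have "Re (a * cnj b + c * cnj d) \<le> cmod (a * cnj b + c * cnj d)"
    by (rule complex_Re_le_cmod)
  also have "\<dots> \<le> cmod a * cmod b + cmod c * cmod d"
    by (metis complex_mod_cnj norm_mult norm_triangle_ineq)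
  also have "\<dots> \<le> (cmod a + cmod c) * (cmod b + cmod d)"
    by (simp add: algebra_simps)
  finally show ?thesis .
qed

text \<open>The Hermitian product of \<open>(z, \<zeta>)\<close> with the point \<open>(w, P w)\<close> of the graph, minus the square norm of
  that point: the exponent of the Bargmann-Fock reproducing kernel with its Gaussian weight.\<close>

definition kernel_exponent :: "complex poly \<Rightarrow> complex \<Rightarrow> complex \<Rightarrow> complex \<Rightarrow> complex" where
  "kernel_exponent P z \<zeta> w = z * cnj w + \<zeta> * cnj (poly P w) - of_real (graph_weight P w)"

lemma kernel_exponent_bound:
  "cmod (exp (kernel_exponent P z \<zeta> w)) \<le>
    exp ((cmod z + cmod \<zeta>) * (cmod w + cmod (poly P w)) - graph_weight P w)"
  using Re_pairing_le[of z w \<zeta> "poly P w"] by (simp add: kernel_exponent_def)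

lemma continuous_on_graph_weight: "continuous_on A (graph_weight P)"
  unfolding graph_weight_def by (intro continuous_intros)

lemma continuous_on_kernel_factor: "continuous_on A (kernel_factor P z)"
  unfolding kernel_factor_def
  by (intro continuous_intros continuous_on_subset[OF holomorphic_on_imp_continuous_on[OF diff_quot_holomorphic]]) auto

lemma continuous_on_kernel_exponent: "continuous_on A (kernel_exponent P z \<zeta>)"
  unfolding kernel_exponent_def by (intro continuous_intros continuous_on_graph_weight)

lemma kernel_factor_polynomial_bound:
  obtains L n where "\<And>w. cmod (kernel_factor P z w) \<le> L * (1 + cmod w) ^ n"
proof -
  let ?m = "degree P - 1"
  obtain L where L: "0 < L"
    "\<And>z w. cmod (kernel_factor P z w) \<le> L * (slope_weight P w)\<^sup>2 * (1 + cmod (w - z)) ^ ?m"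
    using kernel_factor_bound by blast
  show ?thesis
  proof (rule that[of "L * (1 + cmod z) ^ ?m" "?m * 2 + ?m"])
    fix w
    have "(1 + cmod (w - z)) ^ ?m \<le> ((1 + cmod z) * (1 + cmod w)) ^ ?m"
      using one_plus_norm_diff_le[of w z] by (intro power_mono) auto
    then have "L * (slope_weight P w)\<^sup>2 * (1 + cmod (w - z)) ^ ?m \<le>
        L * (slope_weight P w)\<^sup>2 * ((1 + cmod z) * (1 + cmod w)) ^ ?m"
      using L(1) by (intro mult_left_mono) auto
    also have "\<dots> = L * (1 + cmod z) ^ ?m * (1 + cmod w) ^ (?m * 2 + ?m)"
      unfolding slope_weight_def power_mult_distrib power_add power_mult by (simp only: mult_ac)
    finally show "cmod (kernel_factor P z w) \<le> L * (1 + cmod z) ^ ?m * (1 + cmod w) ^ (?m * 2 + ?m)"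
      using L(2)[of z w] by linarith
  qed
qed

lemma diff_quot_polynomial_bound:
  obtains L n where "0 \<le> L" "\<And>w. cmod (diff_quot P z w) \<le> L * (1 + cmod w) ^ n"
proof -
  let ?m = "degree P - 1"
  obtain L where L: "0 \<le> L"
    "\<And>z w. cmod (diff_quot P z w) \<le> L * slope_weight P w * (1 + cmod (w - z)) ^ ?m"
    using diff_quot_bound by blast
  show ?thesis
  proof (rule that[of "L * (1 + cmod z) ^ ?m" "?m + ?m"])
    fix w
    have "(1 + cmod (w - z)) ^ ?m \<le> ((1 + cmod z) * (1 + cmod w)) ^ ?m"
      using one_plus_norm_diff_le[of w z] by (intro power_mono) auto
    then have "L * slope_weight P w * (1 + cmod (w - z)) ^ ?m \<le>
        L * slope_weight P w * ((1 + cmod z) * (1 + cmod w)) ^ ?m"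
      using L(1) slope_weight_ge_1[of P w] by (intro mult_left_mono) auto
    also have "\<dots> = L * (1 + cmod z) ^ ?m * (1 + cmod w) ^ (?m + ?m)"
      by (simp add: slope_weight_def power_mult_distrib power_add)
    finally show "cmod (diff_quot P z w) \<le> L * (1 + cmod z) ^ ?m * (1 + cmod w) ^ (?m + ?m)"
      using L(2)[of z w] by linarith
  qed (use L in auto)
qed

lemma integrable_continuous_bounded_by:
  fixes f :: "complex \<Rightarrow> complex"
  assumes "continuous_on UNIV f" "integrable lborel B" "\<And>w. cmod (f w) \<le> B w"
  shows "integrable lborel f"
proof (rule Bochner_Integration.integrable_bound[OF assms(2)])
  show "f \<in> borel_measurable lborel"
    using borel_measurable_continuous_onI[OF assms(1)] by simp
  show "AE w in lborel. norm (f w) \<le> norm (B w)"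
    using assms(3) by (intro AE_I2) (auto intro: order_trans[OF _ abs_ge_self])
qed

text \<open>The entire function \<open>E x = (exp x - 1) / x\<close>, through the equations and bounds by which it removes the
  singularity of \<open>(1 - exp (- |\<Delta>|\<^sup>2)) / (w - z)\<close> in the reproducing identity. On the negative real axis it
  is bounded by \<open>1\<close> because \<open>1 - exp (- e) \<le> e\<close>.\<close>

lemma exp_difference_quotient:
  obtains E E' :: "complex \<Rightarrow> complex" where
    "\<And>x. (E has_field_derivative E' x) (at x)" "continuous_on UNIV E" "continuous_on UNIV E'"
    "\<And>x. x * E x = exp x - 1" "\<And>x. E x + x * E' x = exp x" "\<And>e. 0 \<le> e \<Longrightarrow> cmod (E (- of_real e)) \<le> 1"
proof -
  obtain E :: "complex \<Rightarrow> complex" where E: "E holomorphic_on UNIV" "\<And>x. (x - 0) * E x = exp x - exp 0"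
    by (rule entire_difference_quotient[of exp 0]) (auto intro: holomorphic_intros)
  have d: "(E has_field_derivative deriv E x) (at x)" for x
    using E(1) by (rule entire_has_field_derivative)
  have xE: "x * E x = exp x - 1" for x using E(2)[of x] by simp
  have sum: "E x + x * deriv E x = exp x" for x
  proof (rule DERIV_unique)
    show "((\<lambda>x. x * E x) has_field_derivative (E x + x * deriv E x)) (at x)"
      by (auto intro!: derivative_eq_intros d)
    show "((\<lambda>x. x * E x) has_field_derivative exp x) (at x)"
      unfolding xE by (auto intro!: derivative_eq_intros)
  qed
  show ?thesis
  proof (rule that[OF d _ _ xE sum])
    show "continuous_on UNIV E" using E(1) by (rule holomorphic_on_imp_continuous_on)
    show "continuous_on UNIV (deriv E)" using E(1) by (rule continuous_on_deriv_entire)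
    fix e :: real assume e: "0 \<le> e"
    show "cmod (E (- of_real e)) \<le> 1"
    proof (cases "e = 0")
      case True
      then show ?thesis using sum[of 0] by simp
    next
      case False
      have "e * cmod (E (- of_real e)) = cmod (- of_real e * E (- of_real e))"
        using e by (simp add: norm_mult)
      also have "\<dots> = cmod (of_real (exp (- e) - 1))"
        unfolding xE by (simp add: exp_of_real[symmetric])
      also have "\<dots> = \<bar>exp (- e) - 1\<bar>" by (simp only: norm_of_real)
      also have "\<dots> \<le> e * 1" using exp_ge_add_one_self[of "- e"] e by (simp add: abs_le_iff)
      finally show ?thesis using e False by simp
    qed
  qed
qed

text \<open>With \<open>gt w = g w * exp ((z - w) * cnj z - (P w - P z) * cnj (P z))\<close>, which is entire and has the
  value \<open>g z\<close> at \<open>z\<close>, the integrand becomes \<open>gt * exp (- S) * kernel_factor P z\<close>. Write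
  \<open>T w = |w - z|\<^sup>2\<close>, \<open>\<Delta> w = P w - P z\<close> and \<open>E w = |\<Delta> w|\<^sup>2\<close>, so that \<open>S = T + E\<close>. Stokes' theorem for
  \<open>(gt w - gt z) / (w - z) * exp (- S w)\<close> replaces \<open>gt\<close> by the constant \<open>gt z\<close>, and Stokes' theorem for
  \<open>(exp (- T w) - exp (- S w)) / (w - z)\<close> replaces \<open>exp (- S) * kernel_factor P z\<close> by \<open>exp (- T)\<close>.
  Both functions are smooth at \<open>z\<close>. The second one is written as
  \<open>exp (- T) * (q * cnj \<Delta> * \<psi> (- E))\<close> with \<open>\<psi> x = (exp x - 1) / x\<close>, where \<open>q\<close> is the difference
  quotient of \<open>P\<close>.\<close>

lemma reproducing_identity:
  fixes P :: "complex poly"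
  assumes g: "g holomorphic_on UNIV"
    and int: "(\<integral>\<^sup>+ w. ennreal ((cmod (g w))\<^sup>2 * exp (- graph_weight P w)) \<partial>lborel) < \<infinity>"
  shows "(\<integral>w. g w * exp (kernel_exponent P z (poly P z) w) * kernel_factor P z w \<partial>lborel) =
    g z * (\<integral>w. exp (- of_real ((cmod w)\<^sup>2)) \<partial>lborel)"
proof -
  let ?p = "poly P" and ?p' = "poly (pderiv P)" and ?q = "diff_quot P z" and ?B = "kernel_factor P z"
  define \<Delta> where "\<Delta> w = ?p w - ?p z" for w
  define T where "T w = (w - z) * cnj (w - z)" for w
  define E where "E w = \<Delta> w * cnj (\<Delta> w)" for w
  define S where "S w = T w + E w" for w
  define gt where "gt w = g w * exp ((z - w) * cnj z - \<Delta> w * cnj (?p z))" for w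
  have gt: "gt holomorphic_on UNIV" unfolding gt_def \<Delta>_def by (intro holomorphic_intros g)
  have gtz: "gt z = g z" by (simp add: gt_def \<Delta>_def)
  obtain k where k: "k holomorphic_on UNIV" "\<And>w. (w - z) * k w = gt w - gt z"
    using entire_difference_quotient[OF gt] by blast
  obtain \<psi> \<psi>' :: "complex \<Rightarrow> complex" where \<psi>: "\<And>x. (\<psi> has_field_derivative \<psi>' x) (at x)"
    "continuous_on UNIV \<psi>" "continuous_on UNIV \<psi>'"
    "\<And>x. x * \<psi> x = exp x - 1" "\<And>x. \<psi> x + x * \<psi>' x = exp x" "\<And>e. 0 \<le> e \<Longrightarrow> cmod (\<psi> (- of_real e)) \<le> 1"
    using exp_difference_quotient by blast
  have q\<Delta>: "(w - z) * ?q w = \<Delta> w" for w unfolding \<Delta>_def by (rule diff_quot_mult)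
  have gtS: "gt w * exp (- S w) = g w * exp (kernel_exponent P z (?p z) w)" for w
  proof -
    have "complex_of_real (graph_weight P w) = w * cnj w + ?p w * cnj (?p w)"
      unfolding graph_weight_def by (simp only: of_real_add of_real_power complex_norm_square[symmetric])
    then have "(z - w) * cnj z - \<Delta> w * cnj (?p z) + - S w = kernel_exponent P z (?p z) w"
      by (simp add: S_def T_def E_def \<Delta>_def kernel_exponent_def algebra_simps)
    then show ?thesis by (simp only: gt_def mult.assoc exp_add[symmetric])
  qed
  have TR: "T w = of_real ((cmod (w - z))\<^sup>2)" and ER: "E w = of_real ((cmod (\<Delta> w))\<^sup>2)" for w
    unfolding T_def E_def complex_norm_square by auto
  have d\<Delta>: "(\<Delta> has_field_derivative ?p' w) (at w)" for w
    unfolding \<Delta>_def by (auto intro!: derivative_eq_intros)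
  have dT: "(T has_derivative (\<lambda>h. cnj (w - z) * h + (w - z) * cnj h)) (at w)" for w
    using has_derivative_wirtinger_norm_square[of "\<lambda>w. w - z" 1 w] unfolding T_def
    by (auto intro!: derivative_eq_intros)
  have dE: "(E has_derivative (\<lambda>h. (?p' w * cnj (\<Delta> w)) * h + (\<Delta> w * cnj (?p' w)) * cnj h)) (at w)" for w
    unfolding E_def by (rule has_derivative_wirtinger_norm_square[OF d\<Delta>])
  have dneg: "((\<lambda>x. exp (- x)) has_field_derivative - exp (- x)) (at x)" for x :: complex
    by (auto intro!: derivative_eq_intros)
  have d\<psi>neg: "((\<lambda>x. \<psi> (- x)) has_field_derivative - \<psi>' (- x)) (at x)" for x
  proof -
    have "(uminus has_field_derivative - 1) (at x)"
      by (auto intro!: derivative_eq_intros)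
    from DERIV_chain2[OF \<psi>(1) this] show ?thesis by simp
  qed
  note dexpT = has_derivative_wirtinger_compose[OF dT dneg]
  note dexpS = has_derivative_wirtinger_compose[OF has_derivative_wirtinger_add[OF dT dE] dneg, folded S_def]
  note dk = has_derivative_wirtinger_holomorphic[OF entire_has_field_derivative[OF k(1)]]
  note dq = has_derivative_wirtinger_holomorphic[OF entire_has_field_derivative[OF diff_quot_holomorphic[of P z]]]
  note d\<Delta>c = has_derivative_wirtinger_cnj[OF has_derivative_wirtinger_holomorphic[OF d\<Delta>]]
  note d\<psi> = has_derivative_wirtinger_compose[OF dE d\<psi>neg]
  note d1 = has_derivative_wirtinger_mult[OF dk dexpS]
  note d2 = has_derivative_wirtinger_mult[OF dexpT
      has_derivative_wirtinger_mult[OF has_derivative_wirtinger_mult[OF dq d\<Delta>c] d\<psi>]]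
  have ck: "continuous_on UNIV k" "continuous_on UNIV (deriv k)"
    using k(1) by (auto intro: holomorphic_on_imp_continuous_on continuous_on_deriv_entire)
  have cq: "continuous_on UNIV ?q" "continuous_on UNIV (deriv ?q)"
    using diff_quot_holomorphic by (auto intro: holomorphic_on_imp_continuous_on continuous_on_deriv_entire)
  have cgt: "continuous_on UNIV gt" using gt by (rule holomorphic_on_imp_continuous_on)
  have c\<Delta>: "continuous_on UNIV \<Delta>" unfolding \<Delta>_def by (intro continuous_intros)
  have cT: "continuous_on UNIV T" unfolding T_def by (intro continuous_intros)
  have cE: "continuous_on UNIV E" unfolding E_def by (intro continuous_intros c\<Delta>)
  have cS: "continuous_on UNIV S" unfolding S_def by (intro continuous_intros cT cE)
  have c\<psi>: "continuous_on UNIV (\<lambda>w. \<psi> (- E w))" "continuous_on UNIV (\<lambda>w. \<psi>' (- E w))"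
    by (intro continuous_on_compose2[OF \<psi>(2)] continuous_on_compose2[OF \<psi>(3)] continuous_intros cE; simp)+
  note cs = ck cq cgt c\<Delta> cT cE cS c\<psi> continuous_on_kernel_factor[of UNIV P z]
  \<comment> \<open>For integrability: \<open>gt * exp (- S)\<close> and \<open>exp (- S)\<close> are at most \<open>|g|\<close>, respectively \<open>1\<close>, times
    \<open>exp (R * (|w| + |P w|) - |w|\<^sup>2 - |P w|\<^sup>2)\<close> for some \<open>R\<close>; the factors made from \<open>P\<close> grow polynomially.\<close>
  have gm: "g \<in> borel_measurable borel"
    by (intro borel_measurable_continuous_onI holomorphic_on_imp_continuous_on[OF g])
  define R where "R = cmod z + cmod (?p z)"
  obtain L n where L: "\<And>w. cmod (?B w) \<le> L * (1 + cmod w) ^ n"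
    using kernel_factor_polynomial_bound by blast
  have bgt: "cmod (gt w * exp (- S w)) \<le> cmod (g w) * exp (R * (cmod w + cmod (?p w)) - graph_weight P w)" for w
    unfolding gtS norm_mult R_def by (intro mult_left_mono kernel_exponent_bound) auto
  have bS: "cmod (exp (- S w)) \<le> exp (2 * R * (cmod w + cmod (?p w)) - graph_weight P w)" for w
  proof -
    have "Re (- S w) = 2 * Re (z * cnj w + ?p z * cnj (?p w)) - graph_weight P w - graph_weight P z"
      unfolding S_def T_def E_def \<Delta>_def graph_weight_def cmod_power2 by (simp add: power2_eq_square algebra_simps)
    also have "\<dots> \<le> 2 * (R * (cmod w + cmod (?p w))) - graph_weight P w"
    proof -
      have "0 \<le> graph_weight P z" by (simp add: graph_weight_def)
      then show ?thesis
        using Re_pairing_le[of z w "?p z" "?p w"] unfolding R_def by linarith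
    qed
    finally show ?thesis by simp
  qed
  have iS: "integrable lborel (\<lambda>w. exp (- S w))"
    by (rule integrable_continuous_bounded_by[OF _ integrable_exp_graph_weight[of 0 "2 * R" P]])
      (use bS in \<open>auto intro!: continuous_intros cs\<close>)
  have iT: "integrable lborel (\<lambda>w. exp (- T w) * f w)"
    if "continuous_on UNIV f" "\<And>w. cmod (f w) \<le> C * (1 + cmod w) ^ m" for f C m
  proof (rule integrable_continuous_bounded_by)
    show "integrable lborel (\<lambda>w. C * ((1 + cmod w) ^ m * exp (2 * cmod z * (cmod w + cmod (poly 0 w)) - graph_weight 0 w)))"
      by (intro integrable_mult_right integrable_exp_graph_weight)
    fix w
    have "Re (- T w) = 2 * Re (z * cnj w) - (cmod w)\<^sup>2 - (cmod z)\<^sup>2"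
      unfolding T_def cmod_power2 by (simp add: power2_eq_square algebra_simps)
    also have "\<dots> \<le> 2 * cmod z * cmod w - (cmod w)\<^sup>2"
      using complex_Re_le_cmod[of "z * cnj w"] zero_le_power2[of "cmod z"]
      unfolding norm_mult complex_mod_cnj by linarith
    finally have "cmod (exp (- T w)) \<le> exp (2 * cmod z * (cmod w + cmod (poly 0 w)) - graph_weight 0 w)"
      by (simp add: graph_weight_def)
    then have "cmod (exp (- T w)) * cmod (f w) \<le>
        exp (2 * cmod z * (cmod w + cmod (poly 0 w)) - graph_weight 0 w) * (C * (1 + cmod w) ^ m)"
      by (intro mult_mono that) auto
    then show "cmod (exp (- T w) * f w) \<le> C * ((1 + cmod w) ^ m * exp (2 * cmod z * (cmod w + cmod (poly 0 w)) - graph_weight 0 w))"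
      by (simp only: norm_mult mult_ac)
  qed (intro continuous_intros cs that)
  have iSB: "integrable lborel (\<lambda>w. exp (- S w) * ?B w)"
  proof (rule integrable_continuous_bounded_by)
    show "integrable lborel (\<lambda>w. L * ((1 + cmod w) ^ n * exp (2 * R * (cmod w + cmod (?p w)) - graph_weight P w)))"
      by (intro integrable_mult_right integrable_exp_graph_weight)
    show "cmod (exp (- S w) * ?B w) \<le> L * ((1 + cmod w) ^ n * exp (2 * R * (cmod w + cmod (?p w)) - graph_weight P w))" for w
      using mult_mono[OF bS[of w] L[of w]] by (simp add: norm_mult mult_ac)
  qed (intro continuous_intros cs)
  have igSB: "integrable lborel (\<lambda>w. gt w * exp (- S w) * ?B w)"
  proof (rule integrable_continuous_bounded_by)
    show "integrable lborel (\<lambda>w. L * (cmod (g w) * (1 + cmod w) ^ n * exp (R * (cmod w + cmod (?p w)) - graph_weight P w)))"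
      by (intro integrable_mult_right integrable_against_graph_weight gm int)
    show "cmod (gt w * exp (- S w) * ?B w) \<le> L * (cmod (g w) * (1 + cmod w) ^ n * exp (R * (cmod w + cmod (?p w)) - graph_weight P w))" for w
      using mult_mono[OF bgt[of w] L[of w]] unfolding norm_mult[of "gt w * exp (- S w)"] by (simp add: mult_ac)
  qed (intro continuous_intros cs)
  \<comment> \<open>\<open>b1\<close> is the \<open>cnj w\<close>-derivative of \<open>k * exp (- S)\<close>, where \<open>k w = (gt w - gt z) / (w - z)\<close>.\<close>
  define b1 where "b1 w = - ((gt w - gt z) * exp (- S w) * ?B w)" for w
  have b1: "0 * exp (- S w) + k w * (- exp (- S w) * ((w - z) + \<Delta> w * cnj (?p' w))) = b1 w" for w
  proof -
    have "0 * exp (- S w) + k w * (- exp (- S w) * ((w - z) + \<Delta> w * cnj (?p' w)))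
        = - (((w - z) * k w) * exp (- S w) * ?B w)"
      unfolding q\<Delta>[of w, symmetric] kernel_factor_def by (simp add: algebra_simps)
    then show ?thesis by (simp add: b1_def k)
  qed
  have "continuous_on (cball z 1) k"
    using ck(1) by (rule continuous_on_subset) auto
  then have "compact (k ` cball z 1)"
    by (rule compact_continuous_image) simp
  then obtain M where M: "\<And>w. w \<in> cball z 1 \<Longrightarrow> cmod (k w) \<le> M"
    by (meson bounded_iff compact_imp_bounded imageI)
  have M0: "0 \<le> M" using order_trans[OF norm_ge_zero M[of z]] by simp
  \<comment> \<open>Near \<open>z\<close> the quotient \<open>k\<close> is bounded by compactness, elsewhere its denominator is at least \<open>1\<close>.\<close>
  have bk: "cmod (k w) \<le> cmod (gt w) + (cmod (gt z) + M)" for w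
  proof (cases "w \<in> cball z 1")
    case True
    show ?thesis using M[OF True] by (simp add: add_increasing)
  next
    case False
    then have "1 * cmod (k w) \<le> cmod (w - z) * cmod (k w)"
      by (intro mult_right_mono) (auto simp: dist_norm norm_minus_commute)
    also have "\<dots> = cmod (gt w - gt z)" by (simp only: k(2) norm_mult[symmetric])
    also have "\<dots> \<le> cmod (gt w) + cmod (gt z)" by (rule norm_triangle_ineq4)
    finally show ?thesis using M0 by simp
  qed
  have igS: "integrable lborel (\<lambda>w. gt w * exp (- S w))"
  proof (rule integrable_continuous_bounded_by[OF _ _ bgt])
    show "integrable lborel (\<lambda>w. cmod (g w) * exp (R * (cmod w + cmod (?p w)) - graph_weight P w))"
      using integrable_against_graph_weight[OF gm int, of 0 R] by simp
  qed (intro continuous_intros cs)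
  have "integrable lborel (\<lambda>w. k w * exp (- S w))"
  proof (rule integrable_continuous_bounded_by)
    show "integrable lborel (\<lambda>w. cmod (gt w * exp (- S w)) + (cmod (gt z) + M) * cmod (exp (- S w)))"
      by (intro Bochner_Integration.integrable_add integrable_mult_right integrable_norm igS iS)
    show "cmod (k w * exp (- S w)) \<le> cmod (gt w * exp (- S w)) + (cmod (gt z) + M) * cmod (exp (- S w))" for w
      using mult_right_mono[OF bk[of w] norm_ge_zero[of "exp (- S w)"]] by (simp only: norm_mult distrib_right)
  qed (intro continuous_intros cs)
  moreover have ib1: "integrable lborel b1"
    unfolding b1_def left_diff_distrib
    using igSB integrable_mult_right[OF iSB, of "gt z"] by (simp add: mult.assoc)
  ultimately have "(\<integral>w. b1 w \<partial>lborel) = 0"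
    by (intro integral_dbar_eq_0[OF d1[unfolded b1]])
      (auto simp: b1_def[abs_def] intro!: continuous_intros cs)
  then have eq1: "(\<integral>w. gt w * exp (- S w) * ?B w \<partial>lborel) = gt z * (\<integral>w. exp (- S w) * ?B w \<partial>lborel)"
    unfolding b1_def left_diff_distrib
    using igSB integrable_mult_right[OF iSB, of "gt z"] by (simp add: mult.assoc)
  \<comment> \<open>\<open>b2\<close> is the \<open>cnj w\<close>-derivative of \<open>exp (- T) * (q * cnj \<Delta> * \<psi> (- E))\<close>.\<close>
  define b2 where "b2 w = exp (- S w) * ?B w - exp (- T w)" for w
  have b2: "- exp (- T w) * (w - z) * (?q w * cnj (\<Delta> w) * \<psi> (- E w)) +
      exp (- T w) * ((0 * cnj (\<Delta> w) + ?q w * cnj (?p' w)) * \<psi> (- E w) +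
        ?q w * cnj (\<Delta> w) * (- \<psi>' (- E w) * (\<Delta> w * cnj (?p' w)))) = b2 w" (is "?l = _") for w
  proof -
    have "?l = exp (- T w) * (- (((w - z) * ?q w) * cnj (\<Delta> w)) * \<psi> (- E w) +
        ?q w * cnj (?p' w) * (\<psi> (- E w) + - (\<Delta> w * cnj (\<Delta> w)) * \<psi>' (- E w)))"
      by (simp add: algebra_simps)
    also have "\<dots> = exp (- T w) * ((exp (- E w) - 1) + ?q w * cnj (?p' w) * exp (- E w))"
      unfolding q\<Delta> E_def[symmetric] \<psi>(4) \<psi>(5) ..
    also have "\<dots> = (exp (- T w) * exp (- E w)) * ?B w - exp (- T w)"
      by (simp add: kernel_factor_def algebra_simps)
    also have "exp (- T w) * exp (- E w) = exp (- S w)"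
      by (simp add: S_def flip: exp_add)
    finally show ?thesis by (simp only: b2_def)
  qed
  obtain K m where K: "0 \<le> K" "\<And>w. cmod (?q w) \<le> K * (1 + cmod w) ^ m"
    using diff_quot_polynomial_bound by blast
  have "integrable lborel (\<lambda>w. exp (- T w) * (?q w * cnj (\<Delta> w) * \<psi> (- E w)))"
  proof (rule iT)
    fix w
    have "cmod (\<psi> (- E w)) \<le> 1" unfolding ER by (intro \<psi>(6)) simp
    moreover have "cmod (\<Delta> w) \<le> (1 + (cmod w + cmod z)) * cmod (?q w)"
    proof -
      have "cmod (\<Delta> w) = cmod (w - z) * cmod (?q w)" by (simp only: q\<Delta> norm_mult[symmetric])
      also have "\<dots> \<le> (1 + (cmod w + cmod z)) * cmod (?q w)"
        using norm_triangle_ineq4[of w z] by (intro mult_right_mono) auto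
      finally show ?thesis .
    qed
    ultimately have "cmod (?q w * cnj (\<Delta> w) * \<psi> (- E w)) \<le>
        cmod (?q w) * ((1 + (cmod w + cmod z)) * cmod (?q w)) * 1"
      unfolding norm_mult complex_mod_cnj by (intro mult_mono) auto
    also have "\<dots> \<le> (K * (1 + cmod w) ^ m) * (((1 + cmod z) * (1 + cmod w)) * (K * (1 + cmod w) ^ m)) * 1"
      using K by (intro mult_mono mult_nonneg_nonneg) (auto simp: algebra_simps)
    also have "\<dots> = K * K * (1 + cmod z) * (1 + cmod w) ^ (m + m + 1)"
      by (simp add: power_add mult_ac)
    finally show "cmod (?q w * cnj (\<Delta> w) * \<psi> (- E w)) \<le> K * K * (1 + cmod z) * (1 + cmod w) ^ (m + m + 1)" .
  qed (intro continuous_intros cs)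
  moreover have iT1: "integrable lborel (\<lambda>w. exp (- T w))"
    using iT[of "\<lambda>_. 1" 1 0] by simp
  moreover have ib2: "integrable lborel b2"
    unfolding b2_def by (intro Bochner_Integration.integrable_diff iSB iT1)
  ultimately have "(\<integral>w. b2 w \<partial>lborel) = 0"
    by (intro integral_dbar_eq_0[OF d2[unfolded b2]])
      (auto simp: b2_def[abs_def] intro!: continuous_intros cs)
  then have eq2: "(\<integral>w. exp (- S w) * ?B w \<partial>lborel) = (\<integral>w. exp (- T w) \<partial>lborel)"
    unfolding b2_def using iSB iT1 by simp
  have eq3: "(\<integral>w. exp (- T w) \<partial>lborel) = (\<integral>w. exp (- of_real ((cmod w)\<^sup>2)) \<partial>lborel)"
  proof -
    have "(\<integral>w. exp (- of_real ((cmod w)\<^sup>2)) \<partial>lborel) =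
        (\<integral>w. exp (- complex_of_real ((cmod w)\<^sup>2)) \<partial>distr lborel borel ((+) (- z)))"
      by (simp only: lborel_distr_plus)
    also have "\<dots> = (\<integral>w. exp (- T w) \<partial>lborel)"
      unfolding TR by (subst integral_distr) auto
    finally show ?thesis ..
  qed
  have "(\<integral>w. g w * exp (kernel_exponent P z (?p z) w) * ?B w \<partial>lborel) = (\<integral>w. gt w * exp (- S w) * ?B w \<partial>lborel)"
    by (simp only: gtS)
  also have "\<dots> = g z * (\<integral>w. exp (- of_real ((cmod w)\<^sup>2)) \<partial>lborel)"
    by (simp only: eq1 eq2 eq3 gtz)
  finally show ?thesis .
qed

section \<open>The extension operator\<close>

definition kernel_extension :: "complex poly \<Rightarrow> (complex \<Rightarrow> complex) \<Rightarrow> complex ^ 2 \<Rightarrow> complex" where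
  "kernel_extension P g v =
    (\<integral>w. g w * exp (kernel_exponent P (v $ 1) (v $ 2) w) * kernel_factor P (v $ 1) w \<partial>lborel)"

lemma vec_nth_measurable [measurable]: "(\<lambda>v :: complex ^ 'n. v $ i) \<in> borel_measurable borel"
  by (intro borel_measurable_continuous_onI continuous_intros)

lemma cnj_measurable [measurable (raw)]:
  "f \<in> borel_measurable M \<Longrightarrow> (\<lambda>x. cnj (f x)) \<in> borel_measurable M"
  by (rule borel_measurable_continuous_on[OF continuous_on_cnj[OF continuous_on_id]])

text \<open>Expanding the difference quotient in powers of \<open>z\<close> turns \<open>kernel_extension\<close> into a finite sum of
  these integrals with polynomial coefficients.\<close>

lemma polynomial_kernel_integral:
  fixes g :: "complex \<Rightarrow> complex" and P r s :: "complex poly"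
  defines "J \<equiv> \<lambda>(v::complex ^ 2) w. (g w * exp (- of_real (graph_weight P w)) * (poly r w * cnj (poly s w))) *
    exp (v $ 1 * cnj w + v $ 2 * cnj (poly P w))"
  assumes [measurable]: "g \<in> borel_measurable borel"
    and int: "(\<integral>\<^sup>+ w. ennreal ((cmod (g w))\<^sup>2 * exp (- graph_weight P w)) \<partial>lborel) < \<infinity>"
  shows "(\<lambda>v. \<integral>w. J v w \<partial>lborel) holomorphic_in UNIV" and "integrable lborel (J v)"
proof -
  obtain A where A: "0 < A" "\<And>w. cmod (poly r w) \<le> A * (1 + cmod w) ^ degree r"
    using poly_growth_upper by blast
  obtain B where B: "0 < B" "\<And>w. cmod (poly s w) \<le> B * (1 + cmod w) ^ degree s"
    using poly_growth_upper by blast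
  have J: "integrable lborel (\<lambda>w. cmod (g w * exp (- of_real (graph_weight P w)) * (poly r w * cnj (poly s w))) *
      exp (R * (cmod (cnj w) + cmod (cnj (poly P w)))))" for R
  proof (rule Bochner_Integration.integrable_bound)
    show "integrable lborel (\<lambda>w. (A * B) * (cmod (g w) * (1 + cmod w) ^ (degree r + degree s) *
      exp (R * (cmod w + cmod (poly P w)) - graph_weight P w)))"
      by (intro integrable_mult_right integrable_against_graph_weight int) measurable
    show "AE w in lborel. norm (cmod (g w * exp (- of_real (graph_weight P w)) * (poly r w * cnj (poly s w))) *
      exp (R * (cmod (cnj w) + cmod (cnj (poly P w))))) \<le> norm ((A * B) * (cmod (g w) * (1 + cmod w) ^ (degree r + degree s) *
      exp (R * (cmod w + cmod (poly P w)) - graph_weight P w)))"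
    proof (rule AE_I2)
      fix w
      let ?e = "exp (R * (cmod w + cmod (poly P w)) - graph_weight P w)"
      have "norm (cmod (g w * exp (- of_real (graph_weight P w)) * (poly r w * cnj (poly s w))) *
          exp (R * (cmod (cnj w) + cmod (cnj (poly P w))))) = (cmod (poly r w) * cmod (poly s w)) * (cmod (g w) * ?e)"
        unfolding norm_mult norm_exp_eq_Re by (simp add: exp_diff exp_minus divide_inverse mult_ac)
      also have "\<dots> \<le> ((A * (1 + cmod w) ^ degree r) * (B * (1 + cmod w) ^ degree s)) * (cmod (g w) * ?e)"
        using A B by (intro mult_mono mult_nonneg_nonneg) (auto intro: less_imp_le)
      also have "\<dots> = (A * B) * (cmod (g w) * (1 + cmod w) ^ (degree r + degree s) * ?e)"
        by (simp add: power_add mult_ac)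
      also have "\<dots> \<le> norm \<dots>" by simp
      finally show "norm (cmod (g w * exp (- of_real (graph_weight P w)) * (poly r w * cnj (poly s w))) *
        exp (R * (cmod (cnj w) + cmod (cnj (poly P w))))) \<le> norm ((A * B) * (cmod (g w) * (1 + cmod w) ^ (degree r + degree s) * ?e))" .
    qed
  qed measurable
  show "(\<lambda>v. \<integral>w. J v w \<partial>lborel) holomorphic_in UNIV"
    unfolding J_def by (intro holomorphic_in_exp_integral J) measurable
  show "integrable lborel (J v)"
  proof (rule Bochner_Integration.integrable_bound[OF J[of "norm v"]])
    show "AE w in lborel. norm (J v w) \<le> norm (cmod (g w * exp (- of_real (graph_weight P w)) * (poly r w * cnj (poly s w))) *
      exp (norm v * (cmod (cnj w) + cmod (cnj (poly P w)))))"
    proof (rule AE_I2)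
      fix w
      have "Re (v $ 1 * cnj w + v $ 2 * cnj (poly P w)) \<le> cmod (v $ 1 * cnj w + v $ 2 * cnj (poly P w))"
        by (rule complex_Re_le_cmod)
      also have "\<dots> \<le> cmod (v $ 1) * cmod (cnj w) + cmod (v $ 2) * cmod (cnj (poly P w))"
        by (metis norm_mult norm_triangle_ineq)
      also have "\<dots> \<le> norm v * cmod (cnj w) + norm v * cmod (cnj (poly P w))"
        by (intro add_mono mult_right_mono Finite_Cartesian_Product.norm_nth_le) auto
      finally have "cmod (exp (v $ 1 * cnj w + v $ 2 * cnj (poly P w))) \<le> exp (norm v * (cmod (cnj w) + cmod (cnj (poly P w))))"
        by (simp add: distrib_left)
      then show "norm (J v w) \<le> norm (cmod (g w * exp (- of_real (graph_weight P w)) * (poly r w * cnj (poly s w))) *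
        exp (norm v * (cmod (cnj w) + cmod (cnj (poly P w)))))"
        unfolding J_def norm_mult real_norm_def abs_mult abs_norm_cancel abs_exp_cancel by (rule mult_left_mono) simp
    qed
    show "J v \<in> borel_measurable lborel" unfolding J_def by measurable
  qed
qed

lemma kernel_extension_holomorphic:
  assumes [measurable]: "g \<in> borel_measurable borel"
    and int: "(\<integral>\<^sup>+ w. ennreal ((cmod (g w))\<^sup>2 * exp (- graph_weight P w)) \<partial>lborel) < \<infinity>"
  shows "kernel_extension P g holomorphic_in UNIV"
proof -
  define J where "J r s v w = (g w * exp (- of_real (graph_weight P w)) * (poly r w * cnj (poly s w))) *
    exp (v $ 1 * cnj w + v $ 2 * cnj (poly P w))" for r s w and v :: "complex ^ 2"
  have J: "(\<lambda>v. \<integral>w. J r s v w \<partial>lborel) holomorphic_in UNIV" "integrable lborel (J r s v)" for r s v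
    unfolding J_def by (rule polynomial_kernel_integral[OF assms])+
  define q where "q i = (\<Sum>k=Suc i..degree P. monom (coeff P k) (k - i - 1))" for i
  have q: "diff_quot P z w = (\<Sum>i<degree P. poly (q i) w * z ^ i)" for z w
    by (simp add: diff_quot_def q_def poly_sum poly_monom)
  have "g w * exp (kernel_exponent P (v $ 1) (v $ 2) w) * kernel_factor P (v $ 1) w =
      J 1 1 v w + (\<Sum>i<degree P. v $ 1 ^ i * J (q i) (pderiv P) v w)" for v w
  proof -
    have "exp (kernel_exponent P (v $ 1) (v $ 2) w) =
        exp (- of_real (graph_weight P w)) * exp (v $ 1 * cnj w + v $ 2 * cnj (poly P w))"
      by (simp add: kernel_exponent_def flip: exp_add)
    then show ?thesis
      by (simp add: kernel_factor_def J_def q sum_distrib_left sum_distrib_right distrib_left mult_ac)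
  qed
  then have "kernel_extension P g = (\<lambda>v. (\<integral>w. J 1 1 v w \<partial>lborel) +
      (\<Sum>i<degree P. v $ 1 ^ i * (\<integral>w. J (q i) (pderiv P) v w \<partial>lborel)))"
    using J(2) by (simp add: kernel_extension_def fun_eq_iff)
  then show ?thesis
    by (auto intro!: holomorphic_in_add holomorphic_in_sum holomorphic_in_mult holomorphic_in_power
        holomorphic_in_component J)
qed

lemma norm_square_vec2: "(norm v)\<^sup>2 = (cmod (v $ 1))\<^sup>2 + (cmod (v $ 2))\<^sup>2" for v :: "complex ^ 2"
  by (simp add: norm_vec_def L2_set_def sum_2 add_nonneg_nonneg)

text \<open>Schur's test: by the Cauchy-Schwarz inequality for the measure \<open>k v w dw\<close>, the square of the
  inner integral is at most \<open>A\<close> times the integral of \<open>(u w)\<^sup>2 * k v w\<close>; then Tonelli's theorem applies.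
  The second marginal is allowed to depend on \<open>w\<close>, so that \<open>k\<close> can carry the density of the area.\<close>

lemma Schur_test:
  fixes k :: "'b \<Rightarrow> 'a \<Rightarrow> real" and u :: "'a \<Rightarrow> real"
  assumes "sigma_finite_measure M" "sigma_finite_measure N"
    and [measurable]: "(\<lambda>(v, w). k v w) \<in> borel_measurable (N \<Otimes>\<^sub>M M)" "u \<in> borel_measurable M"
    and nonneg: "\<And>v w. 0 \<le> k v w" "\<And>w. 0 \<le> u w"
    and A: "\<And>v. (\<integral>\<^sup>+ w. ennreal (k v w) \<partial>M) \<le> A"
    and B: "\<And>w. (\<integral>\<^sup>+ v. ennreal (k v w) \<partial>N) \<le> ennreal (b w)" and b: "\<And>w. 0 \<le> b w" "b \<in> borel_measurable M"
  shows "(\<integral>\<^sup>+ v. (\<integral>\<^sup>+ w. ennreal (u w * k v w) \<partial>M)\<^sup>2 \<partial>N) \<le> A * (\<integral>\<^sup>+ w. ennreal ((u w)\<^sup>2 * b w) \<partial>M)"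
proof -
  interpret M: sigma_finite_measure M by fact
  interpret N: sigma_finite_measure N by fact
  interpret NM: pair_sigma_finite N M ..
  note [measurable] = b(2)
  have [measurable]: "(\<lambda>w. k v w) \<in> borel_measurable M" if "v \<in> space N" for v
    using measurable_compose_Pair1[OF that assms(3)] by simp
  have "(\<integral>\<^sup>+ v. (\<integral>\<^sup>+ w. ennreal (u w * k v w) \<partial>M)\<^sup>2 \<partial>N) \<le>
      (\<integral>\<^sup>+ v. A * (\<integral>\<^sup>+ w. ennreal ((u w)\<^sup>2 * k v w) \<partial>M) \<partial>N)"
  proof (rule nn_integral_mono)
    fix v assume v [simp]: "v \<in> space N"
    have "(\<integral>\<^sup>+ w. ennreal (u w * k v w) \<partial>M)\<^sup>2 =
        (\<integral>\<^sup>+ w. ennreal (sqrt (k v w)) * ennreal (u w * sqrt (k v w)) \<partial>M)\<^sup>2"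
      using nonneg by (intro arg_cong[where f = "\<lambda>x. x\<^sup>2"] nn_integral_cong)
        (simp add: ennreal_mult[symmetric] mult_ac)
    also have "\<dots> \<le> (\<integral>\<^sup>+ w. (ennreal (sqrt (k v w)))\<^sup>2 \<partial>M) * (\<integral>\<^sup>+ w. (ennreal (u w * sqrt (k v w)))\<^sup>2 \<partial>M)"
      by (rule Cauchy_Schwarz_nn_integral) measurable
    also have "\<dots> = (\<integral>\<^sup>+ w. ennreal (k v w) \<partial>M) * (\<integral>\<^sup>+ w. ennreal ((u w)\<^sup>2 * k v w) \<partial>M)"
      using nonneg by (simp add: ennreal_power power_mult_distrib)
    also have "\<dots> \<le> A * (\<integral>\<^sup>+ w. ennreal ((u w)\<^sup>2 * k v w) \<partial>M)"
      by (intro mult_right_mono A) simp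
    finally show "(\<integral>\<^sup>+ w. ennreal (u w * k v w) \<partial>M)\<^sup>2 \<le> A * (\<integral>\<^sup>+ w. ennreal ((u w)\<^sup>2 * k v w) \<partial>M)" .
  qed
  also have "\<dots> = A * (\<integral>\<^sup>+ v. \<integral>\<^sup>+ w. ennreal ((u w)\<^sup>2 * k v w) \<partial>M \<partial>N)"
    by (rule nn_integral_cmult) measurable
  also have "(\<integral>\<^sup>+ v. \<integral>\<^sup>+ w. ennreal ((u w)\<^sup>2 * k v w) \<partial>M \<partial>N) = (\<integral>\<^sup>+ w. \<integral>\<^sup>+ v. ennreal ((u w)\<^sup>2 * k v w) \<partial>N \<partial>M)"
    by (rule NM.Fubini'[symmetric]) measurable
  also have "\<dots> \<le> (\<integral>\<^sup>+ w. ennreal ((u w)\<^sup>2 * b w) \<partial>M)"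
  proof (rule nn_integral_mono)
    fix w assume w [simp]: "w \<in> space M"
    have [measurable]: "(\<lambda>v. k v w) \<in> borel_measurable N"
      using measurable_Pair1[OF assms(3) w] by simp
    have "(\<integral>\<^sup>+ v. ennreal ((u w)\<^sup>2 * k v w) \<partial>N) = ennreal ((u w)\<^sup>2) * (\<integral>\<^sup>+ v. ennreal (k v w) \<partial>N)"
      using nonneg by (simp add: ennreal_mult nn_integral_cmult)
    also have "\<dots> \<le> ennreal ((u w)\<^sup>2) * ennreal (b w)"
      by (intro mult_left_mono B) simp
    finally show "(\<integral>\<^sup>+ v. ennreal ((u w)\<^sup>2 * k v w) \<partial>N) \<le> ennreal ((u w)\<^sup>2 * b w)"
      using b(1) by (simp add: ennreal_mult)
  qed
  finally show ?thesis by (simp add: mult_left_mono)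
qed

lemma kernel_measurable [measurable]:
  "kernel_factor P z \<in> borel_measurable borel" "kernel_exponent P z \<zeta> \<in> borel_measurable borel"
  by (auto intro!: borel_measurable_continuous_onI continuous_on_kernel_factor continuous_on_kernel_exponent)

text \<open>The real part of the exponent is \<open>(|v|\<^sup>2 - \<psi> w - |v - (w, P w)|\<^sup>2) / 2\<close>, where \<open>\<psi>\<close> is the weight of
  the graph. Half of the last Gaussian is spent on the powers of \<open>1 + |w - z|\<close> in the kernel factor.\<close>

lemma kernel_extension_pointwise:
  assumes [measurable]: "g \<in> borel_measurable borel"
  obtains C where "0 \<le> C"
    "\<And>v. ennreal (cmod (kernel_extension P g v) * exp (- (norm v)\<^sup>2 / 2)) \<le>
      (\<integral>\<^sup>+ w. ennreal ((C * cmod (g w) * exp (- graph_weight P w / 2)) * ((slope_weight P w)\<^sup>2 *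
        exp (- ((cmod (w - v $ 1))\<^sup>2 + (cmod (poly P w - v $ 2))\<^sup>2) / 4))) \<partial>lborel)"
proof -
  obtain L where L: "0 < L"
    "\<And>z w. cmod (kernel_factor P z w) \<le> L * (slope_weight P w)\<^sup>2 * (1 + cmod (w - z)) ^ (degree P - 1)"
    using kernel_factor_bound by blast
  let ?m = "degree P - 1"
  define c where "c = fact ?m * exp (1 + 1 / (4 * (1/4 :: real)))"
  have c0: "0 \<le> c" unfolding c_def by simp
  show ?thesis
  proof (rule that[of "L * c"])
    show "0 \<le> L * c" using L c0 by simp
    fix v
    have "ennreal (cmod (kernel_extension P g v) * exp (- (norm v)\<^sup>2 / 2)) =
        ennreal (cmod (kernel_extension P g v)) * ennreal (exp (- (norm v)\<^sup>2 / 2))"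
      by (simp add: ennreal_mult)
    also have "\<dots> \<le> (\<integral>\<^sup>+ w. ennreal (cmod (g w * exp (kernel_exponent P (v $ 1) (v $ 2) w) * kernel_factor P (v $ 1) w)) \<partial>lborel) *
        ennreal (exp (- (norm v)\<^sup>2 / 2))"
    proof (rule mult_right_mono)
      let ?f = "\<lambda>w. g w * exp (kernel_exponent P (v $ 1) (v $ 2) w) * kernel_factor P (v $ 1) w"
      show "ennreal (cmod (kernel_extension P g v)) \<le> (\<integral>\<^sup>+ w. ennreal (cmod (?f w)) \<partial>lborel)"
        unfolding kernel_extension_def
        by (cases "integrable lborel ?f") (auto intro: integral_norm_bound_ennreal simp: not_integrable_integral_eq)
    qed simp
    also have "\<dots> = (\<integral>\<^sup>+ w. ennreal (cmod (g w * exp (kernel_exponent P (v $ 1) (v $ 2) w) * kernel_factor P (v $ 1) w)) *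
        ennreal (exp (- (norm v)\<^sup>2 / 2)) \<partial>lborel)"
      by (rule nn_integral_multc[symmetric]) measurable
    also have "\<dots> \<le> (\<integral>\<^sup>+ w. ennreal ((L * c * cmod (g w) * exp (- graph_weight P w / 2)) * ((slope_weight P w)\<^sup>2 *
        exp (- ((cmod (w - v $ 1))\<^sup>2 + (cmod (poly P w - v $ 2))\<^sup>2) / 4))) \<partial>lborel)"
    proof (rule nn_integral_mono)
      fix w
      let ?z = "v $ 1" and ?\<zeta> = "v $ 2" and ?N = "slope_weight P w"
      define x where "x = (cmod (w - ?z))\<^sup>2"
      define y where "y = (cmod (poly P w - ?\<zeta>))\<^sup>2"
      have "Re (kernel_exponent P ?z ?\<zeta> w) - (norm v)\<^sup>2 / 2 = - graph_weight P w / 2 - (x + y) / 2"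
        unfolding x_def y_def norm_square_vec2 kernel_exponent_def graph_weight_def cmod_power2
        by (simp add: power2_eq_square field_simps)
      then have e: "cmod (exp (kernel_exponent P ?z ?\<zeta> w)) * exp (- (norm v)\<^sup>2 / 2) =
          exp (- graph_weight P w / 2) * exp (- (x + y) / 2)"
      proof -
        have "Re (kernel_exponent P ?z ?\<zeta> w) + - (norm v)\<^sup>2 / 2 = - graph_weight P w / 2 + - (x + y) / 2"
          using \<open>_ = - graph_weight P w / 2 - (x + y) / 2\<close> by linarith
        then show ?thesis
          by (simp only: norm_exp_eq_Re exp_add[symmetric])
      qed
      have t: "(1 + cmod (w - ?z)) ^ ?m \<le> c * exp (1/4 * x)"
        unfolding c_def x_def by (rule power_le_exp_quadratic) auto
      have "cmod (kernel_factor P ?z w) * exp (- (x + y) / 2) \<le> (L * ?N\<^sup>2 * (c * exp (1/4 * x))) * exp (- (x + y) / 2)"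
        using L by (intro mult_right_mono order_trans[OF L(2)] mult_left_mono t) auto
      also have "\<dots> = (L * c * ?N\<^sup>2) * exp (1/4 * x + - (x + y) / 2)"
        by (simp only: exp_add mult_ac)
      also have "\<dots> \<le> (L * c * ?N\<^sup>2) * exp (- (x + y) / 4)"
      proof (rule mult_left_mono)
        have "0 \<le> y" by (simp add: y_def)
        then show "exp (1/4 * x + - (x + y) / 2) \<le> exp (- (x + y) / 4)" by (simp add: field_simps)
      qed (use L c0 in auto)
      finally have "(cmod (g w) * exp (- graph_weight P w / 2)) * (cmod (kernel_factor P ?z w) * exp (- (x + y) / 2)) \<le>
          (cmod (g w) * exp (- graph_weight P w / 2)) * ((L * c * ?N\<^sup>2) * exp (- (x + y) / 4))"
        by (rule mult_left_mono) simp
      also have "\<dots> = (L * c * cmod (g w) * exp (- graph_weight P w / 2)) * (?N\<^sup>2 * exp (- (x + y) / 4))"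
        by (simp only: mult_ac)
      also have "(cmod (g w) * exp (- graph_weight P w / 2)) * (cmod (kernel_factor P ?z w) * exp (- (x + y) / 2)) =
          cmod (g w) * cmod (kernel_factor P ?z w) * (exp (- graph_weight P w / 2) * exp (- (x + y) / 2))"
        by (simp only: mult_ac)
      also have "\<dots> = cmod (g w * exp (kernel_exponent P ?z ?\<zeta> w) * kernel_factor P ?z w) * exp (- (norm v)\<^sup>2 / 2)"
        unfolding e[symmetric] norm_mult by (simp only: mult_ac)
      finally show "ennreal (cmod (g w * exp (kernel_exponent P ?z ?\<zeta> w) * kernel_factor P ?z w)) * ennreal (exp (- (norm v)\<^sup>2 / 2)) \<le>
          ennreal ((L * c * cmod (g w) * exp (- graph_weight P w / 2)) * (?N\<^sup>2 *
            exp (- ((cmod (w - ?z))\<^sup>2 + (cmod (poly P w - ?\<zeta>))\<^sup>2) / 4)))"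
        unfolding x_def[symmetric] y_def[symmetric] by (subst ennreal_mult[symmetric]) (auto intro: ennreal_leI)
    qed
    finally show "ennreal (cmod (kernel_extension P g v) * exp (- (norm v)\<^sup>2 / 2)) \<le> \<dots>" .
  qed
qed

lemma kernel_extension_square_integrable:
  assumes [measurable]: "g \<in> borel_measurable borel"
    and int: "(\<integral>\<^sup>+ w. ennreal ((cmod (g w))\<^sup>2 * exp (- graph_weight P w) * (slope_weight P w)\<^sup>2) \<partial>lborel) < \<infinity>"
  shows "(\<integral>\<^sup>+ v. ennreal ((cmod (kernel_extension P g v))\<^sup>2 * exp (- (norm v)\<^sup>2)) \<partial>lborel) < \<infinity>"
proof -
  obtain C where C: "0 \<le> C"
    "\<And>v. ennreal (cmod (kernel_extension P g v) * exp (- (norm v)\<^sup>2 / 2)) \<le>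
      (\<integral>\<^sup>+ w. ennreal ((C * cmod (g w) * exp (- graph_weight P w / 2)) * ((slope_weight P w)\<^sup>2 *
        exp (- ((cmod (w - v $ 1))\<^sup>2 + (cmod (poly P w - v $ 2))\<^sup>2) / 4))) \<partial>lborel)"
    using kernel_extension_pointwise[OF assms(1)] by blast
  define u where "u w = C * cmod (g w) * exp (- graph_weight P w / 2)" for w
  define k where "k v w = (slope_weight P w)\<^sup>2 * exp (- ((cmod (w - v $ 1))\<^sup>2 + (cmod (poly P w - v $ 2))\<^sup>2) / 4)"
    for w and v :: "complex ^ 2"
  obtain A where A: "A < \<infinity>" "\<And>z \<zeta>. (\<integral>\<^sup>+ w. ennreal ((slope_weight P w)\<^sup>2 *
       exp (- ((cmod (w - z))\<^sup>2 + (cmod (poly P w - \<zeta>))\<^sup>2) / 4)) \<partial>lborel) \<le> A"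
    using graph_gaussian_area_bounded by blast
  define G where "G = enn2real (\<integral>\<^sup>+ v. ennreal (exp (- (1/4) * (norm (v :: complex ^ 2))\<^sup>2)) \<partial>lborel)"
  have G: "ennreal G = (\<integral>\<^sup>+ v. ennreal (exp (- (1/4) * (norm (v :: complex ^ 2))\<^sup>2)) \<partial>lborel)"
    using gaussian_nn_integral_finite[of "1/4", where 'a = "complex ^ 2"] by (simp add: G_def)
  have [measurable]: "u \<in> borel_measurable borel" unfolding u_def by measurable
  have "(\<integral>\<^sup>+ v. ennreal ((cmod (kernel_extension P g v))\<^sup>2 * exp (- (norm v)\<^sup>2)) \<partial>lborel) \<le>
      (\<integral>\<^sup>+ v. (\<integral>\<^sup>+ w. ennreal (u w * k v w) \<partial>lborel)\<^sup>2 \<partial>lborel)"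
  proof (rule nn_integral_mono)
    fix v :: "complex ^ 2"
    have "ennreal ((cmod (kernel_extension P g v))\<^sup>2 * exp (- (norm v)\<^sup>2)) =
        (ennreal (cmod (kernel_extension P g v) * exp (- (norm v)\<^sup>2 / 2)))\<^sup>2"
      by (simp add: ennreal_power power_mult_distrib flip: exp_double)
    also have "\<dots> \<le> (\<integral>\<^sup>+ w. ennreal (u w * k v w) \<partial>lborel)\<^sup>2"
      unfolding u_def k_def by (intro power_mono C) simp
    finally show "ennreal ((cmod (kernel_extension P g v))\<^sup>2 * exp (- (norm v)\<^sup>2)) \<le> \<dots>" .
  qed
  also have "\<dots> \<le> A * (\<integral>\<^sup>+ w. ennreal ((u w)\<^sup>2 * (G * (slope_weight P w)\<^sup>2)) \<partial>lborel)"
  proof (rule Schur_test[OF sigma_finite_lborel sigma_finite_lborel])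
    show "(\<lambda>(v, w). k v w) \<in> borel_measurable (lborel \<Otimes>\<^sub>M lborel)"
      unfolding k_def by measurable
    show "(\<integral>\<^sup>+ w. ennreal (k v w) \<partial>lborel) \<le> A" for v
      unfolding k_def by (rule A)
    show "(\<integral>\<^sup>+ v. ennreal (k v w) \<partial>lborel) \<le> ennreal (G * (slope_weight P w)\<^sup>2)" for w
    proof -
      let ?\<phi> = "vector [w, poly P w] :: complex ^ 2"
      have "k v w = (slope_weight P w)\<^sup>2 * exp (- (1/4) * (norm (v - ?\<phi>))\<^sup>2)" for v
      proof -
        have "(norm (v - ?\<phi>))\<^sup>2 = (cmod (w - v $ 1))\<^sup>2 + (cmod (poly P w - v $ 2))\<^sup>2"
          by (simp add: norm_square_vec2 norm_minus_commute)
        moreover have "- (1/4) * x = - x / 4" for x :: real by simp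
        ultimately show ?thesis by (simp only: k_def)
      qed
      then have "(\<integral>\<^sup>+ v. ennreal (k v w) \<partial>lborel) = ennreal ((slope_weight P w)\<^sup>2) * (\<integral>\<^sup>+ v. ennreal (exp (- (1/4) * (norm (v - ?\<phi>))\<^sup>2)) \<partial>lborel)"
        by (simp add: ennreal_mult nn_integral_cmult)
      also have "\<dots> = ennreal ((slope_weight P w)\<^sup>2) * ennreal G"
        unfolding G nn_integral_gaussian_translate ..
      also have "\<dots> = ennreal (G * (slope_weight P w)\<^sup>2)"
        by (simp add: G_def ennreal_mult mult.commute)
      finally show ?thesis by simp
    qed
  qed (auto simp: k_def u_def G_def C(1))
  also have "(\<integral>\<^sup>+ w. ennreal ((u w)\<^sup>2 * (G * (slope_weight P w)\<^sup>2)) \<partial>lborel) =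
      ennreal (C\<^sup>2 * G) * (\<integral>\<^sup>+ w. ennreal ((cmod (g w))\<^sup>2 * exp (- graph_weight P w) * (slope_weight P w)\<^sup>2) \<partial>lborel)"
  proof -
    have "(u w)\<^sup>2 * (G * (slope_weight P w)\<^sup>2) = (C\<^sup>2 * G) * ((cmod (g w))\<^sup>2 * exp (- graph_weight P w) * (slope_weight P w)\<^sup>2)" for w
      unfolding u_def power_mult_distrib exp_double[symmetric] by simp
    then have "ennreal ((u w)\<^sup>2 * (G * (slope_weight P w)\<^sup>2)) =
        ennreal (C\<^sup>2 * G) * ennreal ((cmod (g w))\<^sup>2 * exp (- graph_weight P w) * (slope_weight P w)\<^sup>2)" for w
      by (simp only:) (rule ennreal_mult, auto simp: G_def)
    then show ?thesis
      by (simp only:) (rule nn_integral_cmult, measurable)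
  qed
  finally show ?thesis
    by (rule le_less_trans) (use A(1) int in \<open>simp add: ennreal_mult_less_top\<close>)
qed

section \<open>The graph as a parametrized surface\<close>

definition graph_map :: "complex poly \<Rightarrow> complex \<Rightarrow> complex ^ 2" where
  "graph_map P z = axis 1 z + axis 2 (poly P z)"

lemma axis_nth_2 [simp]: "axis 1 x $ (2::2) = 0" "axis 2 x $ (1::2) = 0" "axis 1 x $ (1::2) = x" "axis 2 x $ (2::2) = x"
  by (auto simp: axis_def)

lemma graph_map_nth [simp]: "graph_map P z $ 1 = z" "graph_map P z $ 2 = poly P z"
  by (auto simp: graph_map_def)

lemma vec2_eq_iff: "v = w \<longleftrightarrow> v $ 1 = w $ 1 \<and> v $ 2 = w $ 2" for v w :: "'a ^ 2"
  by (simp add: vec_eq_iff forall_2)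

lemma range_graph_map: "range (graph_map P) = {w. w $ 2 = poly P (w $ 1)}"
  by (auto simp: vec2_eq_iff image_iff)

lemma bounded_linear_axis: "bounded_linear (axis i :: complex \<Rightarrow> complex ^ 'n::finite)"
  by (rule linear_conv_bounded_linear[THEN iffD1], rule linearI) (auto simp: axis_def vec_eq_iff)

lemma graph_map_has_derivative:
  "(graph_map P has_derivative (\<lambda>h. axis 1 h + axis 2 (poly (pderiv P) z * h))) (at z)"
  unfolding graph_map_def[abs_def]
  by (intro has_derivative_add bounded_linear_imp_has_derivative bounded_linear_axis
      bounded_linear.has_derivative[OF bounded_linear_axis] poly_DERIV[unfolded has_field_derivative_def])

lemma graph_map_continuous: "continuous_on A (graph_map P)"
  using graph_map_has_derivative
  by (meson continuous_at_imp_continuous_on has_derivative_continuous)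

lemma local_parametrization_graph_map:
  "local_parametrization {w. w $ 2 = poly P (w $ 1)} UNIV (graph_map P)"
  unfolding local_parametrization_def
proof (intro conjI)
  let ?W = "{w. w $ 2 = poly P (w $ 1)}"
  show "openin (top_of_set ?W) (range (graph_map P))"
    by (simp add: range_graph_map)
  show "\<exists>\<psi>. homeomorphism UNIV (range (graph_map P)) (graph_map P) \<psi>"
    by (intro exI[of _ "\<lambda>v. v $ 1"] homeomorphismI graph_map_continuous continuous_intros) auto
  define A :: "2 \<Rightarrow> complex \<Rightarrow>\<^sub>L (complex ^ 2)" where "A i = Blinfun (axis i)" for i
  have A: "blinfun_apply (A i) = axis i" for i
    unfolding A_def by (rule bounded_linear_Blinfun_apply[OF bounded_linear_axis])
  define D where "D z = A 1 + (A 2 o\<^sub>L blinfun_mult_right (poly (pderiv P) z))" for z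
  have D: "blinfun_apply (D z) = (\<lambda>h. axis 1 h + axis 2 (poly (pderiv P) z * h))" for z
    by (simp add: D_def fun_eq_iff blinfun.bilinear_simps A)
  show "\<exists>\<phi>' :: complex \<Rightarrow> complex \<Rightarrow>\<^sub>L (complex ^ 2). continuous_on UNIV \<phi>' \<and>
      (\<forall>x\<in>UNIV. (graph_map P has_derivative blinfun_apply (\<phi>' x)) (at x) \<and> inj (blinfun_apply (\<phi>' x)))"
  proof (intro exI[of _ D] conjI ballI)
    show "continuous_on UNIV D"
      unfolding D_def by (intro continuous_intros)
    show "(graph_map P has_derivative blinfun_apply (D x)) (at x)" for x
      unfolding D by (rule graph_map_has_derivative)
    show "inj (blinfun_apply (D x))" for x
      unfolding D by (intro injI) (simp add: vec2_eq_iff)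
  qed
qed simp

text \<open>The parametrization is conformal: the columns of its Jacobian matrix are orthogonal and both have
  the square length \<open>1 + |P'|\<^sup>2\<close>.\<close>

lemma gram_det_graph_map:
  "sqrt (gram_det (frechet_derivative (graph_map P) (at z))) = 1 + (cmod (poly (pderiv P) z))\<^sup>2"
proof -
  let ?p = "poly (pderiv P) z"
  define L :: "complex \<Rightarrow> complex ^ 2" where "L h = axis 1 h + axis 2 (?p * h)" for h
  have L: "frechet_derivative (graph_map P) (at z) = L"
    using frechet_derivative_at[OF graph_map_has_derivative[of P z]] by (simp add: L_def[abs_def])
  have inner: "L a \<bullet> L b = a \<bullet> b + (?p * a) \<bullet> (?p * b)" for a b
    by (simp add: L_def inner_vec_def sum_2)
  have p: "{p. p permutes (Basis :: complex set)} = {id, Transposition.transpose 1 \<i>}"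
    by (auto simp: Basis_complex_def permutes_doubleton_iff)
  have ne: "id \<noteq> Transposition.transpose (1::complex) \<i>"
    by (metis complex_i_not_one id_apply transpose_apply_first)
  have "gram_det L = (L 1 \<bullet> L 1) * (L \<i> \<bullet> L \<i>) - (L 1 \<bullet> L \<i>) * (L \<i> \<bullet> L 1)"
    using ne unfolding gram_det_def p by (simp add: Basis_complex_def sign_swap_id)
  also have "\<dots> = (1 + (cmod ?p)\<^sup>2)\<^sup>2"
  proof -
    have "L 1 \<bullet> L 1 = 1 + (cmod ?p)\<^sup>2" "L \<i> \<bullet> L \<i> = 1 + (cmod ?p)\<^sup>2" "L 1 \<bullet> L \<i> = 0"
      unfolding inner by (simp_all add: power2_norm_eq_inner[symmetric] norm_mult inner_complex_def[of 1] inner_complex_def[of ?p])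
    then show ?thesis by (simp add: power2_eq_square)
  qed
  finally show ?thesis by (simp add: L)
qed

lemma sets_volume_measure: "sets (volume_measure D S) = sets (restrict_space borel S)"
  unfolding volume_measure_def using sets.sigma_sets_eq[of "restrict_space borel S"]
    sets.space_closed[of "restrict_space borel S"]
  by (subst sets_measure_of) (auto simp: space_restrict_space)

text \<open>The volume of a Borel subset of the graph is a supremum over packings, and the subset itself,
  parametrized by \<open>graph_map\<close>, is a packing by a single piece.\<close>

lemma graph_area_le_volume:
  fixes f :: "complex ^ 2 \<Rightarrow> ennreal" and P :: "complex poly"
  defines "W \<equiv> {w. w $ 2 = poly P (w $ 1)}"
  assumes [measurable]: "f \<in> borel_measurable borel"
  shows "(\<integral>\<^sup>+ z. f (graph_map P z) * ennreal (1 + (cmod (poly (pderiv P) z))\<^sup>2) \<partial>lborel) \<le>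
    (\<integral>\<^sup>+ w. f w \<partial>volume_measure TYPE(complex) W)"
proof -
  let ?R = "restrict_space borel W"
  let ?D = "density lborel (\<lambda>z. ennreal (1 + (cmod (poly (pderiv P) z))\<^sup>2))"
  have gm: "graph_map P \<in> measurable ?D ?R"
    by (rule measurable_restrict_space2)
      (auto simp: W_def intro!: borel_measurable_continuous_onI graph_map_continuous)
  have sets: "sets (distr ?D ?R (graph_map P)) = sets (volume_measure TYPE(complex) W)"
    by (simp add: sets_volume_measure)
  have "distr ?D ?R (graph_map P) \<le> volume_measure TYPE(complex) W"
    unfolding le_measure[OF sets]
  proof
    fix B assume "B \<in> sets (distr ?D ?R (graph_map P))"
    then have B: "B \<in> sets ?R" by simp
    let ?A = "graph_map P -` B"
    have A: "?A \<in> sets borel"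
      using measurable_sets[OF gm B] by simp
    have BW: "B \<subseteq> W" using sets.sets_into_space[OF B] by (simp add: space_restrict_space)
    let ?t = "(graph_map P, ?A)"
    have "{?t} \<in> packings W B"
      using A local_parametrization_graph_map[of P]
      by (auto simp: packings_def parametrized_pieces_def disjoint_family_on_def piece_image_def W_def)
    then have "(\<Sum>t\<in>{?t}. piece_volume t) \<le> emeasure (volume_measure TYPE(complex) W) B"
      unfolding emeasure_volume_measure[OF B] by (rule SUP_upper)
    moreover have "emeasure (distr ?D ?R (graph_map P)) B = piece_volume ?t"
      using A gm B by (simp add: emeasure_distr emeasure_density piece_volume_def gram_det_graph_map)
    ultimately show "emeasure (distr ?D ?R (graph_map P)) B \<le> emeasure (volume_measure TYPE(complex) W) B"
      by simp
  qed
  then have "(\<integral>\<^sup>+ w. f w \<partial>distr ?D ?R (graph_map P)) \<le> (\<integral>\<^sup>+ w. f w \<partial>volume_measure TYPE(complex) W)"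
    by (rule nn_integral_mono_measure[OF sets])
  moreover have "(\<integral>\<^sup>+ w. f w \<partial>distr ?D ?R (graph_map P)) = (\<integral>\<^sup>+ z. f (graph_map P z) \<partial>?D)"
    by (rule nn_integral_distr[OF gm]) (simp add: measurable_restrict_space1)
  moreover have "\<dots> = (\<integral>\<^sup>+ z. ennreal (1 + (cmod (poly (pderiv P) z))\<^sup>2) * f (graph_map P z) \<partial>lborel)"
  proof (rule nn_integral_density)
    have [measurable]: "graph_map P \<in> borel_measurable borel"
      by (intro borel_measurable_continuous_onI graph_map_continuous)
    show "(\<lambda>z. f (graph_map P z)) \<in> borel_measurable lborel" by measurable
  qed measurable
  ultimately show ?thesis by (simp add: mult.commute)
qed

section \<open>Interpolation\<close>

lemma graph_restriction_holomorphic: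
  assumes f: "holomorphic_on_subvariety f {w. w $ 2 = poly P (w $ 1)}"
  shows "(\<lambda>z. f (graph_map P z)) holomorphic_on UNIV"
  unfolding holomorphic_on_def
proof
  fix z
  let ?W = "{w. w $ 2 = poly P (w $ 1)}"
  have "graph_map P z \<in> ?W" by simp
  then obtain U G where U: "open U" "graph_map P z \<in> U" "G holomorphic_in U" "\<forall>w\<in>?W \<inter> U. f w = G w"
    using f unfolding holomorphic_on_subvariety_def by blast
  then obtain D where D: "(G has_derivative D) (at (graph_map P z))" "\<And>c v. D (c *s v) = c * D v"
    unfolding holomorphic_in_def by blast
  let ?h = "axis 1 1 + axis 2 (poly (pderiv P) z) :: complex ^ 2"
  have "((\<lambda>z. G (graph_map P z)) has_derivative (\<lambda>h. D (axis 1 h + axis 2 (poly (pderiv P) z * h)))) (at z)"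
    by (rule has_derivative_compose[OF graph_map_has_derivative D(1)])
  moreover have "D (axis 1 h + axis 2 (poly (pderiv P) z * h)) = D ?h * h" for h
  proof -
    have "axis 1 h + axis 2 (poly (pderiv P) z * h) = h *s ?h"
      by (simp add: vec2_eq_iff)
    then show ?thesis by (simp only: D(2) mult.commute)
  qed
  ultimately have "((\<lambda>z. G (graph_map P z)) has_field_derivative D ?h) (at z)"
    by (simp only: has_field_derivative_def)
  moreover have "open (graph_map P -` U)"
    using U(1) graph_map_continuous by (rule open_vimage)
  ultimately have "((\<lambda>z. f (graph_map P z)) has_field_derivative D ?h) (at z)"
    using U(2,4) by (elim has_field_derivative_transform_within_open) auto
  then show "(\<lambda>z. f (graph_map P z)) field_differentiable (at z within UNIV)"
    by (auto simp: field_differentiable_def)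
qed

lemma norm_graph_map: "(norm (graph_map P z))\<^sup>2 = graph_weight P z"
  by (simp add: norm_square_vec2 graph_weight_def)

lemma complex_gaussian_integral_nonzero:
  "(\<integral>w. exp (- complex_of_real ((cmod w)\<^sup>2)) \<partial>lborel) \<noteq> 0"
proof
  assume "(\<integral>w. exp (- complex_of_real ((cmod w)\<^sup>2)) \<partial>lborel) = 0"
  moreover have "exp (- complex_of_real ((cmod w)\<^sup>2)) = complex_of_real (exp (- 1 * (cmod w)\<^sup>2))" for w
    by (simp flip: exp_of_real)
  ultimately have "(\<integral>w. exp (- 1 * (cmod w)\<^sup>2) \<partial>lborel) = 0"
    by (simp only: integral_complex_of_real of_real_eq_0_iff)
  then have "AE w::complex in lborel. exp (- 1 * (cmod w)\<^sup>2) = 0"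
    by (subst (asm) integral_nonneg_eq_0_iff_AE) (use integrable_gaussian[of 1, where 'a = complex] in auto)
  then have "AE w::complex in lborel. False" by simp
  then have "emeasure lborel (UNIV :: complex set) = 0"
    by (simp add: AE_iff_null null_sets_def)
  then show False by simp
qed

lemma graph_analytic_hypersurface:
  fixes P :: "complex poly"
  shows "analytic_hypersurface {w :: complex ^ 2. w $ 2 = poly P (w $ 1)}"
  unfolding analytic_hypersurface_def
proof (intro allI exI conjI)
  let ?h = "\<lambda>w :: complex ^ 2. w $ 2 + poly (- P) (w $ 1)"
  show "?h holomorphic_in UNIV"
    by (intro holomorphic_in_add holomorphic_in_poly holomorphic_in_component)
  show "\<exists>w\<in>UNIV. ?h w \<noteq> 0"
    by (intro bexI[of _ "vector [0, 1 + poly P 0]"]) simp_all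
qed (auto simp: algebra_simps)

theorem theorem1p2:
  fixes P :: "complex poly"
  shows "interpolating TYPE(complex) {w :: complex ^ 2. w $ 2 = poly P (w $ 1)}"
  unfolding interpolating_def
proof (intro conjI allI impI)
  let ?W = "{w :: complex ^ 2. w $ 2 = poly P (w $ 1)}"
  show "DIM(complex) + 2 = 2 * CARD(2)" by simp
  show "analytic_hypersurface ?W" by (rule graph_analytic_hypersurface)
  fix f :: "complex ^ 2 \<Rightarrow> complex"
  assume f: "holomorphic_on_subvariety f ?W"
    and fin: "(\<integral>\<^sup>+ z. ennreal ((cmod (f z))\<^sup>2 * exp (- (norm z)\<^sup>2)) \<partial>volume_measure TYPE(complex) ?W) < \<infinity>"
  define g where "g z = f (graph_map P z)" for z
  have g: "g holomorphic_on UNIV"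
    unfolding g_def using f by (rule graph_restriction_holomorphic)
  have gm [measurable]: "g \<in> borel_measurable borel"
    by (intro borel_measurable_continuous_onI holomorphic_on_imp_continuous_on[OF g])
  have fW: "f v = g (v $ 1)" if "v \<in> ?W" for v
  proof -
    have "graph_map P (v $ 1) = v" using that by (simp add: vec2_eq_iff)
    then show ?thesis by (simp add: g_def)
  qed
  have "(\<integral>\<^sup>+ z. ennreal ((cmod (g z))\<^sup>2 * exp (- graph_weight P z)) * ennreal (1 + (cmod (poly (pderiv P) z))\<^sup>2) \<partial>lborel)
      \<le> (\<integral>\<^sup>+ v. ennreal ((cmod (g (v $ 1)))\<^sup>2 * exp (- (norm v)\<^sup>2)) \<partial>volume_measure TYPE(complex) ?W)"
  proof -
    have "(\<lambda>v :: complex ^ 2. ennreal ((cmod (g (v $ 1)))\<^sup>2 * exp (- (norm v)\<^sup>2))) \<in> borel_measurable borel"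
      by measurable
    from graph_area_le_volume[OF this, of P] show ?thesis
      by (simp only: norm_graph_map graph_map_nth)
  qed
  also have "\<dots> = (\<integral>\<^sup>+ v. ennreal ((cmod (f v))\<^sup>2 * exp (- (norm v)\<^sup>2)) \<partial>volume_measure TYPE(complex) ?W)"
  proof (rule nn_integral_cong)
    fix v assume "v \<in> space (volume_measure TYPE(complex) ?W)"
    also have "space (volume_measure TYPE(complex) ?W) = ?W"
      using sets_eq_imp_space_eq[OF sets_volume_measure[where S = ?W]] by (simp add: space_restrict_space)
    finally show "ennreal ((cmod (g (v $ 1)))\<^sup>2 * exp (- (norm v)\<^sup>2)) = ennreal ((cmod (f v))\<^sup>2 * exp (- (norm v)\<^sup>2))"
      by (simp only: fW)
  qed
  finally have fin1: "(\<integral>\<^sup>+ z. ennreal ((cmod (g z))\<^sup>2 * exp (- graph_weight P z)) *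
      ennreal (1 + (cmod (poly (pderiv P) z))\<^sup>2) \<partial>lborel) < \<infinity>"
    using fin by (rule le_less_trans)
  \<comment> \<open>The area element dominates the square of the weight that the estimate of the kernel involves.\<close>
  obtain A where A: "0 < A" "\<And>w. slope_weight P w \<le> A * (1 + cmod (poly (pderiv P) w))"
    using slope_weight_lower by blast
  have "(\<integral>\<^sup>+ w. ennreal ((cmod (g w))\<^sup>2 * exp (- graph_weight P w) * (slope_weight P w)\<^sup>2) \<partial>lborel) \<le>
      (\<integral>\<^sup>+ w. ennreal (2 * A\<^sup>2) * (ennreal ((cmod (g w))\<^sup>2 * exp (- graph_weight P w)) *
        ennreal (1 + (cmod (poly (pderiv P) w))\<^sup>2)) \<partial>lborel)"
  proof (rule nn_integral_mono)
    fix w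
    have "(slope_weight P w)\<^sup>2 \<le> (A * (1 + cmod (poly (pderiv P) w)))\<^sup>2"
      using slope_weight_ge_1[of P w] by (intro power_mono A) simp
    also have "\<dots> \<le> A\<^sup>2 * (2 * (1\<^sup>2 + (cmod (poly (pderiv P) w))\<^sup>2))"
      unfolding power_mult_distrib by (intro mult_left_mono add_square_le) simp
    finally have "(cmod (g w))\<^sup>2 * exp (- graph_weight P w) * (slope_weight P w)\<^sup>2 \<le>
        (cmod (g w))\<^sup>2 * exp (- graph_weight P w) * (A\<^sup>2 * (2 * (1\<^sup>2 + (cmod (poly (pderiv P) w))\<^sup>2)))"
      by (rule mult_left_mono) simp
    also have "\<dots> = (2 * A\<^sup>2) * (((cmod (g w))\<^sup>2 * exp (- graph_weight P w)) * (1 + (cmod (poly (pderiv P) w))\<^sup>2))"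
      by (simp only: power_one mult_ac)
    finally have "ennreal ((cmod (g w))\<^sup>2 * exp (- graph_weight P w) * (slope_weight P w)\<^sup>2) \<le> ennreal \<dots>"
      by (rule ennreal_leI)
    also have "\<dots> = ennreal (2 * A\<^sup>2) * (ennreal ((cmod (g w))\<^sup>2 * exp (- graph_weight P w)) *
        ennreal (1 + (cmod (poly (pderiv P) w))\<^sup>2))"
      by (subst ennreal_mult, simp, simp, subst ennreal_mult, simp, simp, rule refl)
    finally show "ennreal ((cmod (g w))\<^sup>2 * exp (- graph_weight P w) * (slope_weight P w)\<^sup>2) \<le> \<dots>" .
  qed
  also have "\<dots> = ennreal (2 * A\<^sup>2) * (\<integral>\<^sup>+ w. ennreal ((cmod (g w))\<^sup>2 * exp (- graph_weight P w)) *
        ennreal (1 + (cmod (poly (pderiv P) w))\<^sup>2) \<partial>lborel)"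
    by (rule nn_integral_cmult) measurable
  also have "\<dots> < \<infinity>"
    using fin1 by (simp add: ennreal_mult_less_top)
  finally have finN: "(\<integral>\<^sup>+ w. ennreal ((cmod (g w))\<^sup>2 * exp (- graph_weight P w) * (slope_weight P w)\<^sup>2) \<partial>lborel) < \<infinity>" .
  have "(\<integral>\<^sup>+ w. ennreal ((cmod (g w))\<^sup>2 * exp (- graph_weight P w)) \<partial>lborel) \<le>
      (\<integral>\<^sup>+ w. ennreal ((cmod (g w))\<^sup>2 * exp (- graph_weight P w) * (slope_weight P w)\<^sup>2) \<partial>lborel)"
  proof (intro nn_integral_mono ennreal_leI)
    fix w
    have "(cmod (g w))\<^sup>2 * exp (- graph_weight P w) * 1 \<le>
        (cmod (g w))\<^sup>2 * exp (- graph_weight P w) * (slope_weight P w)\<^sup>2"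
      using slope_weight_ge_1[of P w] by (intro mult_left_mono one_le_power) auto
    then show "(cmod (g w))\<^sup>2 * exp (- graph_weight P w) \<le>
        (cmod (g w))\<^sup>2 * exp (- graph_weight P w) * (slope_weight P w)\<^sup>2" by simp
  qed
  then have fin0: "(\<integral>\<^sup>+ w. ennreal ((cmod (g w))\<^sup>2 * exp (- graph_weight P w)) \<partial>lborel) < \<infinity>"
    using finN by (rule le_less_trans)
  define c where "c = (\<integral>w. exp (- complex_of_real ((cmod w)\<^sup>2)) \<partial>lborel)"
  have c: "c \<noteq> 0" unfolding c_def by (rule complex_gaussian_integral_nonzero)
  have "(\<lambda>v. inverse c * kernel_extension P g v) \<in> bargmann_fock"
  proof -
    have "(\<integral>\<^sup>+ v. ennreal ((cmod (inverse c * kernel_extension P g v))\<^sup>2 * exp (- (norm v)\<^sup>2)) \<partial>lborel) =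
        ennreal ((cmod (inverse c))\<^sup>2) * (\<integral>\<^sup>+ v. ennreal ((cmod (kernel_extension P g v))\<^sup>2 * exp (- (norm v)\<^sup>2)) \<partial>lborel)"
    proof -
      have [measurable]: "kernel_extension P g \<in> borel_measurable borel"
        by (rule borel_measurable_continuous_onI[OF holomorphic_in_imp_continuous_on[OF
                kernel_extension_holomorphic[OF gm fin0]]])
      have "ennreal ((cmod (inverse c * kernel_extension P g v))\<^sup>2 * exp (- (norm v)\<^sup>2)) =
          ennreal ((cmod (inverse c))\<^sup>2) * ennreal ((cmod (kernel_extension P g v))\<^sup>2 * exp (- (norm v)\<^sup>2))" for v
        by (subst ennreal_mult[symmetric]) (simp_all add: norm_mult power_mult_distrib mult.assoc)
      then show ?thesis
        by (simp only:) (rule nn_integral_cmult, measurable)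
    qed
    also have "\<dots> < \<infinity>"
      using kernel_extension_square_integrable[OF gm finN] by (simp add: ennreal_mult_less_top)
    finally show ?thesis
      unfolding bargmann_fock_def mem_Collect_eq
      by (intro conjI holomorphic_in_mult holomorphic_in_const kernel_extension_holomorphic[OF gm fin0])
  qed
  moreover have "inverse c * kernel_extension P g v = f v" if v: "v \<in> ?W" for v
  proof -
    have "kernel_extension P g v = g (v $ 1) * c"
      using reproducing_identity[OF g fin0, of "v $ 1"] v by (simp add: kernel_extension_def c_def)
    then show ?thesis
      unfolding fW[OF v] using c by simp
  qed
  ultimately show "\<exists>F\<in>bargmann_fock. \<forall>z\<in>?W. F z = f z"
    by (intro bexI[of _ "\<lambda>v. inverse c * kernel_extension P g v"] ballI)
qed

end
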